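(* Let $\mathbf F:\mathbf X\to\mathbf Y$ be an omega pseudo-functor. If both $\mathbf X$ and $\mathbf Y$ are $n$-skeletal then $\mathbf F$ is tame.
   Context: A globular set $X$ is a sequence of sets $X_i$ ($i\ge 0$; elements are called $i$-cells) with functions $dom_{i-1}^i,cod_{i-1}^i:X_i\to X_{i-1}$ ($i>0$) satisfying $dom_{i-1}^i dom_i^{i+1}=dom_{i-1}^i cod_i^{i+1}$ and $cod_{i-1}^i dom_i^{i+1}=cod_{i-1}^i cod_i^{i+1}$. For $i<j$, $dom_i^j,cod_i^j:X_j\to X_i$ are the iterated composites. An omega graph is a globular set with functions $id_i^{i-1}:X_{i-1}\to X_i$ ($i>0$) with $dom_{i-1}^i id_i^{i-1}x=x=cod_{i-1}^i id_i^{i-1}x$; $id_j^i$ denotes the iterated composite $X_i\to X_j$. Cells in the image of $id_i^{i-1}$ are identity cells; an omega graph is $n$-skeletal if every cell of dimension $>n$ is an identity cell. An omega magma is an omega graph with, for all $0\le i<j$, a partial binary operation $a\circ_i^j b$ on $j$-cells, defined exactly when $cod_i^j a=dom_i^j b$, such that: if $i+1=j$, then $dom_i^j(a\circ_i^j b)=dom_i^j a$ and $cod_i^j(a\circ_i^j b)=cod_i^j b$; if $i+1<j$, then $dom_{j-1}^j(a\circ_i^j b)=dom_{j-1}^ja\circ_i^{j-1}dom_{j-1}^jb$ and likewise for $cod_{j-1}^j$. Morphisms of globular sets, omega graphs and omega magmas preserve all the respective structure. A strict omega category is an omega magma in which (whenever the composites are defined) $(a\circ_i^jb)\circ_i^jc=a\circ_i^j(b\circ_i^jc)$;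 $(a\circ_j^kb)\circ_i^k(c\circ_j^kd)=(a\circ_i^kc)\circ_j^k(b\circ_i^kd)$ for $i<j<k$; $a=id_j^i(dom_i^ja)\circ_i^ja=a\circ_i^jid_j^i(cod_i^ja)$; and $id_{j+1}^j(a)\circ_i^{j+1}id_{j+1}^j(b)=id_{j+1}^j(a\circ_i^jb)$ for $i<j$. Two $i$-cells $a,b$ are parallel, $a\parallel b$, if they have the same $dom_{i-1}^i$ and the same $cod_{i-1}^i$; any two $0$-cells are parallel. A bridge relation $R$ on an omega graph (or omega magma) $X$ is a sequence $R_i\subseteq X_i\times X_i\times X_{i+1}$ ($i\ge0$) such that: $(a,b,c)\in R_i$ implies $a\parallel b$, $dom_i^{i+1}c=a$, $cod_i^{i+1}c=b$; $(a,a,id_{i+1}^ia)\in R_i$ for all $a\in X_i$; $(a,b,c),(a,b,d)\in R_i$ implies $c=d$. The diagonal bridge relation $R^\Delta$ consists of all triples $(a,a,id_{i+1}^ia)$. A bridge morphism $F:(X,R^X)\to(Y,R^Y)$ is an omega magma morphism with $(a,b,c)\in R_i^X\Rightarrow(Fa,Fb,Fc)\in R_i^Y$. A categorical Penon morphism is a bridge morphism $F:(X,R^X)\to(Y,R^Y)$ such that $Y$ is a strict omega category, $R^Y=R^\Delta$; $(a,b,c)\in R_i^X$ implies $Fa=Fb$ and $Fc=id_{i+1}^i(Fa)$; and if $a,b\in X_i$, $a\parallel b$, $Fa=Fb$, then there is $c$ with $(a,b,c)\in R_i^X$. A weak omega category $\mathbf X$ consists of omega magmas $X_1$ (the underlying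 magma) and $X_2$, an omega magma morphism $\lambda^X:X_2\to X_1$, a morphism $\rho^X:X_1\to X_2$ of omega graphs with $\lambda^X\circ\rho^X=1$ (as omega graph morphisms), a bridge relation $R^X$ on $X_2$, a strict omega category $X_3$, and a categorical Penon morphism $\kappa^X:(X_2,R^X)\to(X_3,R^\Delta)$. It is $n$-skeletal if $X_1$ is $n$-skeletal. An omega pseudo-functor $\mathbf F:\mathbf X\to\mathbf Y$ is a triple of morphisms of globular sets $F_i:X_i\to Y_i$ ($i=1,2,3$) such that $F_3$ is a morphism of omega graphs; $F_1\lambda^X=\lambda^YF_2$ and $F_3\kappa^X=\kappa^YF_2$ as morphisms of globular sets; and $\kappa^Y(F_2a\circ_{j-1}^jF_2b)=\kappa^YF_2(a\circ_{j-1}^jb)$ whenever $a\circ_{j-1}^jb$ is defined in $X_2$. Internal equivalences. An omega clique is an omega magma $M$ with a bridge relation $R^M$ such that for every parallel pair $a,b\in M_j$ there is $c$ with $(a,b,c)\in R_j^M$. Let $K(2)$ be the omega graph with exactly two $0$-cells $1,2$ and all other cells identities on these. $Cl(2)$ is the omega clique freely generated by $K(2)$: it comes with an omega graph morphism $K(2)\to Cl(2)$, and every omega graph morphism from $K(2)$ to an omega clique extends uniquely to a bridge morphism from $Cl(2)$. For $i,j\in\{1,2\}$ let $c(i,j)$ be the unique $1$-cell with $(i,j,c(i,j))\in R_1^{Cl(2)}$ (bridge from the $0$-cell $i$ to the $0$-cell $j$). For an omega magma $M$ and $(i-1)$-cells $a,b$, $M(a,b)$ is the omega magma with $M(a,b)_j=\{c\in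 M_{i+j}: dom_{i-1}^{i+j}c=a,\ cod_{i-1}^{i+j}c=b\}$ and structure that of $M$ restricted and reindexed. A $1$-cell $f$ of $M$ is an elementary internal equivalence if it is an identity cell or there is an omega magma morphism $H:Cl(2)\to M$ with $H(c(1,2))=f$; for $i\ge2$ an $i$-cell $f$ is one if it is an identity cell or there is an omega magma morphism $H:Cl(2)\to M(dom_{i-2}^if,cod_{i-2}^if)$ with $H(c(1,2))=f$. $el(M)$ is the graded subset of these ($el(M)_0=\emptyset$). For a graded subset $S\subseteq M$, $\overline S$ is the smallest graded subset containing all (iterated) composites of elements of $S$, including the elements of $S$; and $T(S)$ is the smallest graded subset containing, for every $k\ge1$, every $f\in M_k$ for which there are $g\in M_k$ with $dom_{k-1}^kg=cod_{k-1}^kf$, $cod_{k-1}^kg=dom_{k-1}^kf$, and $h,h'\in S$ with $dom_k^{k+1}h=f\circ_{k-1}^kg$, $cod_k^{k+1}h=id_k^{k-1}dom_{k-1}^kf$, $dom_k^{k+1}h'=g\circ_{k-1}^kf$, $cod_k^{k+1}h'=id_k^{k-1}cod_{k-1}^kf$. Put $S_1(M)=\overline{el(M)}$, $S_i(M)=\overline{S_{i-1}(M)\cup T(S_{i-1}(M))}$ for $i\ge2$, and $Eq(M)=\bigcup_{i\ge1}S_i(M)$, the graded subset of internal equivalences. An omega pseudo-functor $\mathbf F:\mathbf X\to\mathbf Y$ is tame if $F_1(Eq(X_1))\subseteq Eq(Y_1)$. *)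

theory Defs
  imports Main
begin

text \<open>
  Cells of dimension \<open>k\<close> are the elements of the carrier \<open>cells X k\<close>; the carriers of different
  dimensions need not be disjoint, so the dimension is always passed explicitly. The index of a
  one-step operation is the lower of the two dimensions involved: \<open>dom1 X k\<close> and \<open>cod1 X k\<close>
  go from \<open>(k+1)\<close>-cells to \<open>k\<close>-cells and \<open>id1 X k\<close> goes from \<open>k\<close>-cells to \<open>(k+1)\<close>-cells.
  All operations are total functions whose values outside the carriers are irrelevant.
\<close>

section \<open>Globular sets, omega graphs, omega magmas\<close>

record 'a globset =
  cells :: "nat \<Rightarrow> 'a set"
  dom1 :: "nat \<Rightarrow> 'a \<Rightarrow> 'a"
  cod1 :: "nat \<Rightarrow> 'a \<Rightarrow> 'a"

record 'a ograph = "'a globset" +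
  id1 :: "nat \<Rightarrow> 'a \<Rightarrow> 'a"

text \<open>\<open>cmp M i j a b\<close> is the composite of the \<open>j\<close>-cells \<open>a\<close>, \<open>b\<close> along the dimension \<open>i < j\<close>.\<close>

record 'a omagma = "'a ograph" +
  cmp :: "nat \<Rightarrow> nat \<Rightarrow> 'a \<Rightarrow> 'a \<Rightarrow> 'a"

text \<open>Iterated operations between the dimensions \<open>i \<le> j\<close>; for \<open>i = j\<close> they are the identity.\<close>

primrec domn :: "('a, 'm) globset_scheme \<Rightarrow> nat \<Rightarrow> nat \<Rightarrow> 'a \<Rightarrow> 'a" where
  "domn X i 0 x = x"
| "domn X i (Suc j) x = (if i \<le> j then domn X i j (dom1 X j x) else x)"

primrec codn :: "('a, 'm) globset_scheme \<Rightarrow> nat \<Rightarrow> nat \<Rightarrow> 'a \<Rightarrow> 'a" where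
  "codn X i 0 x = x"
| "codn X i (Suc j) x = (if i \<le> j then codn X i j (cod1 X j x) else x)"

primrec idn :: "('a, 'm) ograph_scheme \<Rightarrow> nat \<Rightarrow> nat \<Rightarrow> 'a \<Rightarrow> 'a" where
  "idn X i 0 x = x"
| "idn X i (Suc j) x = (if i \<le> j then id1 X j (idn X i j x) else x)"

definition parallel :: "('a, 'm) globset_scheme \<Rightarrow> nat \<Rightarrow> 'a \<Rightarrow> 'a \<Rightarrow> bool" where
  "parallel X k a b \<longleftrightarrow> a \<in> cells X k \<and> b \<in> cells X k \<and>
     (\<forall>m. k = Suc m \<longrightarrow> dom1 X m a = dom1 X m b \<and> cod1 X m a = cod1 X m b)"

locale globular_set =
  fixes X :: "('a, 'm) globset_scheme"
  assumes dom1_cell: "x \<in> cells X (Suc k) \<Longrightarrow> dom1 X k x \<in> cells X k"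
    and cod1_cell: "x \<in> cells X (Suc k) \<Longrightarrow> cod1 X k x \<in> cells X k"
    and dom1_dom1: "x \<in> cells X (Suc (Suc k)) \<Longrightarrow>
      dom1 X k (dom1 X (Suc k) x) = dom1 X k (cod1 X (Suc k) x)"
    and cod1_cod1: "x \<in> cells X (Suc (Suc k)) \<Longrightarrow>
      cod1 X k (dom1 X (Suc k) x) = cod1 X k (cod1 X (Suc k) x)"

locale omega_graph = globular_set X for X :: "('a, 'm) ograph_scheme" +
  assumes id1_cell: "x \<in> cells X k \<Longrightarrow> id1 X k x \<in> cells X (Suc k)"
    and dom1_id1: "x \<in> cells X k \<Longrightarrow> dom1 X k (id1 X k x) = x"
    and cod1_id1: "x \<in> cells X k \<Longrightarrow> cod1 X k (id1 X k x) = x"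

definition identity_cell :: "('a, 'm) ograph_scheme \<Rightarrow> nat \<Rightarrow> 'a \<Rightarrow> bool" where
  "identity_cell X k f \<longleftrightarrow> (\<exists>m. k = Suc m \<and> f \<in> id1 X m ` cells X m)"

definition skeletal :: "nat \<Rightarrow> ('a, 'm) ograph_scheme \<Rightarrow> bool" where
  "skeletal n X \<longleftrightarrow> (\<forall>k>n. \<forall>f\<in>cells X k. identity_cell X k f)"

definition composable :: "('a, 'm) globset_scheme \<Rightarrow> nat \<Rightarrow> nat \<Rightarrow> 'a \<Rightarrow> 'a \<Rightarrow> bool" where
  "composable M i j a b \<longleftrightarrow>
     i < j \<and> a \<in> cells M j \<and> b \<in> cells M j \<and> codn M i j a = domn M i j b"

locale omega_magma = omega_graph M for M :: "'a omagma" +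
  assumes cmp_cell: "composable M i j a b \<Longrightarrow> cmp M i j a b \<in> cells M j"
    and dom1_cmp_top: "composable M i (Suc i) a b \<Longrightarrow>
      dom1 M i (cmp M i (Suc i) a b) = dom1 M i a"
    and cod1_cmp_top: "composable M i (Suc i) a b \<Longrightarrow>
      cod1 M i (cmp M i (Suc i) a b) = cod1 M i b"
    and dom1_cmp: "i < m \<Longrightarrow> composable M i (Suc m) a b \<Longrightarrow>
      dom1 M m (cmp M i (Suc m) a b) = cmp M i m (dom1 M m a) (dom1 M m b)"
    and cod1_cmp: "i < m \<Longrightarrow> composable M i (Suc m) a b \<Longrightarrow>
      cod1 M m (cmp M i (Suc m) a b) = cmp M i m (cod1 M m a) (cod1 M m b)"

locale strict_omega_category = omega_magma M for M :: "'a omagma" +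
  assumes cmp_assoc:
    "composable M i j a b \<Longrightarrow> composable M i j (cmp M i j a b) c \<Longrightarrow>
     composable M i j b c \<Longrightarrow> composable M i j a (cmp M i j b c) \<Longrightarrow>
     cmp M i j (cmp M i j a b) c = cmp M i j a (cmp M i j b c)"
    and interchange:
    "i < j \<Longrightarrow> j < k \<Longrightarrow>
     composable M j k a b \<Longrightarrow> composable M j k c d \<Longrightarrow>
     composable M i k (cmp M j k a b) (cmp M j k c d) \<Longrightarrow>
     composable M i k a c \<Longrightarrow> composable M i k b d \<Longrightarrow>
     composable M j k (cmp M i k a c) (cmp M i k b d) \<Longrightarrow>
     cmp M i k (cmp M j k a b) (cmp M j k c d) = cmp M j k (cmp M i k a c) (cmp M i k b d)"
    and cmp_unit_left: "i < j \<Longrightarrow> a \<in> cells M j \<Longrightarrow> cmp M i j (idn M i j (domn M i j a)) a = a"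
    and cmp_unit_right: "i < j \<Longrightarrow> a \<in> cells M j \<Longrightarrow> cmp M i j a (idn M i j (codn M i j a)) = a"
    and cmp_id1: "composable M i j a b \<Longrightarrow>
      cmp M i (Suc j) (id1 M j a) (id1 M j b) = id1 M j (cmp M i j a b)"

section \<open>Morphisms\<close>

definition globular_morphism ::
    "('a, 'm) globset_scheme \<Rightarrow> ('b, 'n) globset_scheme \<Rightarrow> (nat \<Rightarrow> 'a \<Rightarrow> 'b) \<Rightarrow> bool" where
  "globular_morphism X Y F \<longleftrightarrow>
     (\<forall>k. \<forall>x\<in>cells X k. F k x \<in> cells Y k) \<and>
     (\<forall>k. \<forall>x\<in>cells X (Suc k). F k (dom1 X k x) = dom1 Y k (F (Suc k) x)) \<and>
     (\<forall>k. \<forall>x\<in>cells X (Suc k). F k (cod1 X k x) = cod1 Y k (F (Suc k) x))"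

definition graph_morphism ::
    "('a, 'm) ograph_scheme \<Rightarrow> ('b, 'n) ograph_scheme \<Rightarrow> (nat \<Rightarrow> 'a \<Rightarrow> 'b) \<Rightarrow> bool" where
  "graph_morphism X Y F \<longleftrightarrow> globular_morphism X Y F \<and>
     (\<forall>k. \<forall>x\<in>cells X k. F (Suc k) (id1 X k x) = id1 Y k (F k x))"

definition magma_morphism :: "'a omagma \<Rightarrow> 'b omagma \<Rightarrow> (nat \<Rightarrow> 'a \<Rightarrow> 'b) \<Rightarrow> bool" where
  "magma_morphism X Y F \<longleftrightarrow> graph_morphism X Y F \<and>
     (\<forall>i j a b. composable X i j a b \<longrightarrow> F j (cmp X i j a b) = cmp Y i j (F j a) (F j b))"

section \<open>Bridge relations and categorical Penon morphisms\<close>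

text \<open>The component \<open>R k\<close> consists of triples of two \<open>k\<close>-cells and a \<open>(k+1)\<close>-cell between them.\<close>

type_synonym 'a bridges = "nat \<Rightarrow> ('a \<times> 'a \<times> 'a) set"

definition bridge_relation :: "('a, 'm) ograph_scheme \<Rightarrow> 'a bridges \<Rightarrow> bool" where
  "bridge_relation X R \<longleftrightarrow>
     (\<forall>k a b c. (a, b, c) \<in> R k \<longrightarrow>
        a \<in> cells X k \<and> b \<in> cells X k \<and> c \<in> cells X (Suc k) \<and>
        parallel X k a b \<and> dom1 X k c = a \<and> cod1 X k c = b) \<and>
     (\<forall>k. \<forall>a\<in>cells X k. (a, a, id1 X k a) \<in> R k) \<and>
     (\<forall>k a b c d. (a, b, c) \<in> R k \<longrightarrow> (a, b, d) \<in> R k \<longrightarrow> c = d)"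

definition diagonal_bridges :: "('a, 'm) ograph_scheme \<Rightarrow> 'a bridges" where
  "diagonal_bridges X k = {(a, a, id1 X k a) |a. a \<in> cells X k}"

definition bridge_morphism ::
    "'a omagma \<Rightarrow> 'a bridges \<Rightarrow> 'b omagma \<Rightarrow> 'b bridges \<Rightarrow> (nat \<Rightarrow> 'a \<Rightarrow> 'b) \<Rightarrow> bool" where
  "bridge_morphism X R Y S F \<longleftrightarrow> magma_morphism X Y F \<and>
     (\<forall>k a b c. (a, b, c) \<in> R k \<longrightarrow> (F k a, F k b, F (Suc k) c) \<in> S k)"

definition categorical_Penon_morphism ::
    "'a omagma \<Rightarrow> 'a bridges \<Rightarrow> 'b omagma \<Rightarrow> 'b bridges \<Rightarrow> (nat \<Rightarrow> 'a \<Rightarrow> 'b) \<Rightarrow> bool" where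
  "categorical_Penon_morphism X R Y S F \<longleftrightarrow>
     omega_magma X \<and> bridge_relation X R \<and>
     strict_omega_category Y \<and> S = diagonal_bridges Y \<and>
     bridge_morphism X R Y S F \<and>
     (\<forall>k a b c. (a, b, c) \<in> R k \<longrightarrow> F k a = F k b \<and> F (Suc k) c = id1 Y k (F k a)) \<and>
     (\<forall>k a b. parallel X k a b \<longrightarrow> F k a = F k b \<longrightarrow> (\<exists>c. (a, b, c) \<in> R k))"

section \<open>Weak omega categories and omega pseudo-functors\<close>

record ('a, 'b, 'c) weak_ocat =
  mag1 :: "'a omagma"
  mag2 :: "'b omagma"
  mag3 :: "'c omagma"
  lam :: "nat \<Rightarrow> 'b \<Rightarrow> 'a"
  rho :: "nat \<Rightarrow> 'a \<Rightarrow> 'b"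
  bridges :: "'b bridges"
  kappa :: "nat \<Rightarrow> 'b \<Rightarrow> 'c"

locale weak_omega_category =
  fixes X :: "('a, 'b, 'c) weak_ocat"
  assumes mag1: "omega_magma (mag1 X)"
    and mag2: "omega_magma (mag2 X)"
    and lam: "magma_morphism (mag2 X) (mag1 X) (lam X)"
    and rho: "graph_morphism (mag1 X) (mag2 X) (rho X)"
    and lam_rho: "x \<in> cells (mag1 X) k \<Longrightarrow> lam X k (rho X k x) = x"
    and bridges: "bridge_relation (mag2 X) (bridges X)"
    and mag3: "strict_omega_category (mag3 X)"
    and kappa: "categorical_Penon_morphism (mag2 X) (bridges X)
      (mag3 X) (diagonal_bridges (mag3 X)) (kappa X)"

definition weak_skeletal :: "nat \<Rightarrow> ('a, 'b, 'c) weak_ocat \<Rightarrow> bool" where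
  "weak_skeletal n X \<longleftrightarrow> skeletal n (mag1 X)"

record ('a1, 'a2, 'a3, 'b1, 'b2, 'b3) pseudofun =
  fun1 :: "nat \<Rightarrow> 'a1 \<Rightarrow> 'b1"
  fun2 :: "nat \<Rightarrow> 'a2 \<Rightarrow> 'b2"
  fun3 :: "nat \<Rightarrow> 'a3 \<Rightarrow> 'b3"

locale omega_pseudofunctor = X: weak_omega_category X + Y: weak_omega_category Y
  for X :: "('a1, 'a2, 'a3) weak_ocat" and Y :: "('b1, 'b2, 'b3) weak_ocat" +
  fixes F :: "('a1, 'a2, 'a3, 'b1, 'b2, 'b3) pseudofun"
  assumes fun1: "globular_morphism (mag1 X) (mag1 Y) (fun1 F)"
    and fun2: "globular_morphism (mag2 X) (mag2 Y) (fun2 F)"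
    and fun3: "graph_morphism (mag3 X) (mag3 Y) (fun3 F)"
    and fun1_lam: "x \<in> cells (mag2 X) k \<Longrightarrow> fun1 F k (lam X k x) = lam Y k (fun2 F k x)"
    and fun3_kappa: "x \<in> cells (mag2 X) k \<Longrightarrow> fun3 F k (kappa X k x) = kappa Y k (fun2 F k x)"
    and kappa_cmp: "composable (mag2 X) k (Suc k) a b \<Longrightarrow>
      kappa Y (Suc k) (cmp (mag2 Y) k (Suc k) (fun2 F (Suc k) a) (fun2 F (Suc k) b)) =
      kappa Y (Suc k) (fun2 F (Suc k) (cmp (mag2 X) k (Suc k) a b))"

section \<open>Omega cliques and the free clique on two points\<close>

definition omega_clique :: "'a omagma \<Rightarrow> 'a bridges \<Rightarrow> bool" where
  "omega_clique M R \<longleftrightarrow> omega_magma M \<and> bridge_relation M R \<and>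
     (\<forall>k a b. parallel M k a b \<longrightarrow> (\<exists>c. (a, b, c) \<in> R k))"

definition K2 :: "nat ograph" where
  "K2 = \<lparr>cells = \<lambda>k. {1, 2}, dom1 = \<lambda>k x. x, cod1 = \<lambda>k x. x, id1 = \<lambda>k x. x\<rparr>"

text \<open>
  A universal property over cliques on arbitrary types cannot be used as a definition inside HOL,
  so the free clique on \<^const>\<open>K2\<close> is built from terms; it is shown below that it is an omega
  clique and has the universal property with respect to omega cliques on every type. The only
  identification forced by the axioms of an omega clique is that the bridge from a cell to itself
  is an identity cell; it is implemented by allowing the constructor \<open>Brg\<close> for distinct cells
  only. \<open>Cmp i j a b\<close> is the formal composite of the \<open>j\<close>-cells \<open>a\<close>, \<open>b\<close> along dimension \<open>i\<close>.
\<close>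

datatype cl2 = Pt nat | Idc cl2 | Cmp nat nat cl2 cl2 | Brg cl2 cl2

primrec cldom :: "cl2 \<Rightarrow> cl2" where
  "cldom (Pt p) = Pt p"
| "cldom (Idc a) = a"
| "cldom (Cmp i j a b) = (if j = Suc i then cldom a else Cmp i (j - 1) (cldom a) (cldom b))"
| "cldom (Brg a b) = a"

primrec clcod :: "cl2 \<Rightarrow> cl2" where
  "clcod (Pt p) = Pt p"
| "clcod (Idc a) = a"
| "clcod (Cmp i j a b) = (if j = Suc i then clcod b else Cmp i (j - 1) (clcod a) (clcod b))"
| "clcod (Brg a b) = b"

inductive clcell :: "nat \<Rightarrow> cl2 \<Rightarrow> bool" where
  Pt: "p \<in> {1, 2} \<Longrightarrow> clcell 0 (Pt p)"
| Idc: "clcell k a \<Longrightarrow> clcell (Suc k) (Idc a)"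
| Cmp: "i < j \<Longrightarrow> clcell j a \<Longrightarrow> clcell j b \<Longrightarrow> (clcod ^^ (j - i)) a = (cldom ^^ (j - i)) b \<Longrightarrow>
    clcell j (Cmp i j a b)"
| Brg: "clcell k a \<Longrightarrow> clcell k b \<Longrightarrow> a \<noteq> b \<Longrightarrow>
    (0 < k \<Longrightarrow> cldom a = cldom b \<and> clcod a = clcod b) \<Longrightarrow> clcell (Suc k) (Brg a b)"

definition Cl2 :: "cl2 omagma" where
  "Cl2 = \<lparr>cells = \<lambda>k. {t. clcell k t}, dom1 = \<lambda>k. cldom, cod1 = \<lambda>k. clcod, id1 = \<lambda>k. Idc,
     cmp = Cmp\<rparr>"

definition Cl2_bridges :: "cl2 bridges" where
  "Cl2_bridges k =
     {(a, b, c). parallel Cl2 k a b \<and> c = (if a = b then Idc a else Brg a b)}"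

definition K2_Cl2 :: "nat \<Rightarrow> nat \<Rightarrow> cl2" where
  "K2_Cl2 k p = idn Cl2 0 k (Pt p)"

definition clc :: "nat \<Rightarrow> nat \<Rightarrow> cl2" where
  "clc p q = (THE c. (K2_Cl2 0 p, K2_Cl2 0 q, c) \<in> Cl2_bridges 0)"

lemma Cl2_simps [simp]:
  "t \<in> cells Cl2 k \<longleftrightarrow> clcell k t" "dom1 Cl2 k = cldom" "cod1 Cl2 k = clcod" "id1 Cl2 k = Idc"
  "cmp Cl2 = Cmp"
  by (simp_all add: Cl2_def)

lemma K2_simps [simp]:
  "p \<in> cells K2 k \<longleftrightarrow> p = 1 \<or> p = 2" "dom1 K2 k x = x" "cod1 K2 k x = x" "id1 K2 k x = x"
  by (simp_all add: K2_def)

lemma clcell_Cmp_iff: "clcell k (Cmp i j a b) \<longleftrightarrow>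
    k = j \<and> i < j \<and> clcell j a \<and> clcell j b \<and> (clcod ^^ (j - i)) a = (cldom ^^ (j - i)) b"
  by (subst clcell.simps) auto

lemma Cl2_domn: "domn Cl2 i j = cldom ^^ (j - i)"
proof (induction j)
  case (Suc j)
  then show ?case by (cases "i \<le> j") (auto simp: fun_eq_iff Suc_diff_le funpow_swap1)
qed (auto simp: fun_eq_iff)

lemma Cl2_codn: "codn Cl2 i j = clcod ^^ (j - i)"
proof (induction j)
  case (Suc j)
  then show ?case by (cases "i \<le> j") (auto simp: fun_eq_iff Suc_diff_le funpow_swap1)
qed (auto simp: fun_eq_iff)

lemma Cl2_composable: "composable Cl2 i j a b \<longleftrightarrow> clcell j (Cmp i j a b)"
  by (auto simp: composable_def Cl2_domn Cl2_codn clcell_Cmp_iff)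

lemma Cl2_parallel: "parallel Cl2 k a b \<longleftrightarrow>
    clcell k a \<and> clcell k b \<and> (0 < k \<longrightarrow> cldom a = cldom b \<and> clcod a = clcod b)"
  by (cases k) (auto simp: parallel_def)

lemma clc_neq:
  assumes "p \<in> {1, 2}" "q \<in> {1, 2}" "p \<noteq> q"
  shows "clc p q = Brg (Pt p) (Pt q)"
  using clcell.Pt[OF assms(1)] clcell.Pt[OF assms(2)] assms(3)
  by (simp add: clc_def K2_Cl2_def Cl2_bridges_def Cl2_parallel)

lemma clc_same:
  assumes "p \<in> {1, 2}"
  shows "clc p p = Idc (Pt p)"
  using clcell.Pt[OF assms] by (simp add: clc_def K2_Cl2_def Cl2_bridges_def Cl2_parallel)

lemma clcell_boundary:
  assumes "clcell k t" "k = Suc m"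
  shows "clcell m (cldom t) \<and> clcell m (clcod t) \<and>
    (0 < m \<longrightarrow> cldom (cldom t) = cldom (clcod t) \<and> clcod (cldom t) = clcod (clcod t))"
  using assms
proof (induction arbitrary: m)
  case (Cmp i j a b)
  note A = Cmp.IH(1)[OF Cmp.prems] and B = Cmp.IH(2)[OF Cmp.prems]
  show ?case
  proof (cases "i = m")
    case True
    then show ?thesis using A B Cmp by auto
  next
    case False
    then have im: "i < m" using Cmp by simp
    define d where "d = m - Suc i"
    have d: "m - i = Suc d" "j - i = Suc (Suc d)" using im Cmp.prems by (auto simp: d_def)
    have g: "(clcod ^^ Suc d) (cldom a) = (cldom ^^ Suc d) (cldom b)"
      "(clcod ^^ Suc d) (clcod a) = (cldom ^^ Suc d) (clcod b)"
      using Cmp.hyps(4) A B im unfolding d by (simp_all add: funpow_swap1)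
    have "clcell m (Cmp i m (cldom a) (cldom b))" "clcell m (Cmp i m (clcod a) (clcod b))"
      using A B im g d by (auto intro!: clcell.Cmp)
    then show ?thesis using A B im Cmp.prems False by auto
  qed
qed (auto simp: gr0_conv_Suc)

lemma Cl2_omega_magma: "omega_magma Cl2"
proof -
  have *: "clcell j a \<and> clcell j b \<and> i < j" if "clcell j (Cmp i j a b)" for i j a b
    using that by (simp add: clcell_Cmp_iff)
  show ?thesis
    by unfold_locales
      (auto simp: Cl2_composable dest: clcell_boundary clcell_boundary[OF _ refl] * intro: clcell.Idc)
qed

lemma Cl2_bridge_cell: "(a, b, c) \<in> Cl2_bridges k \<Longrightarrow> clcell (Suc k) c"
  by (auto simp: Cl2_bridges_def Cl2_parallel intro: clcell.intros split: if_splits)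

theorem Cl2_omega_clique: "omega_clique Cl2 Cl2_bridges"
proof -
  have "bridge_relation Cl2 Cl2_bridges"
    unfolding bridge_relation_def
    by (auto simp: Cl2_bridge_cell)
      (auto simp: Cl2_bridges_def Cl2_parallel split: if_splits)
  then show ?thesis
    by (auto simp: omega_clique_def Cl2_omega_magma Cl2_bridges_def)
qed

lemma K2_omega_graph: "omega_graph K2"
  by unfold_locales auto

lemma clcell_idn: "clcell 0 t \<Longrightarrow> clcell k (idn Cl2 0 k t)"
  by (induction k) (auto intro: clcell.Idc)

lemma K2_Cl2_morphism: "graph_morphism K2 Cl2 K2_Cl2"
  by (auto simp: graph_morphism_def globular_morphism_def K2_Cl2_def intro!: clcell_idn clcell.Pt
      intro: clcell.Idc)

primrec cldim :: "cl2 \<Rightarrow> nat" where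
  "cldim (Pt p) = 0"
| "cldim (Idc a) = Suc (cldim a)"
| "cldim (Cmp i j a b) = j"
| "cldim (Brg a b) = Suc (cldim a)"

lemma clcell_cldim: "clcell k t \<Longrightarrow> cldim t = k"
  by (induction rule: clcell.induct) auto

primrec clext :: "'a omagma \<Rightarrow> 'a bridges \<Rightarrow> (nat \<Rightarrow> nat \<Rightarrow> 'a) \<Rightarrow> cl2 \<Rightarrow> 'a" where
  "clext M R \<phi> (Pt p) = \<phi> 0 p"
| "clext M R \<phi> (Idc a) = id1 M (cldim a) (clext M R \<phi> a)"
| "clext M R \<phi> (Cmp i j a b) = cmp M i j (clext M R \<phi> a) (clext M R \<phi> b)"
| "clext M R \<phi> (Brg a b) = (THE c. (clext M R \<phi> a, clext M R \<phi> b, c) \<in> R (cldim a))"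

context
  fixes M :: "'a omagma" and R :: "'a bridges" and \<phi> :: "nat \<Rightarrow> nat \<Rightarrow> 'a"
  assumes clique: "omega_clique M R" and \<phi>: "graph_morphism K2 M \<phi>"
begin

interpretation omega_magma M
  using clique by (simp add: omega_clique_def)

definition clext_ok :: "nat \<Rightarrow> cl2 \<Rightarrow> bool" where
  "clext_ok k t \<longleftrightarrow> clext M R \<phi> t \<in> cells M k \<and>
     (\<forall>m. k = Suc m \<longrightarrow> clext M R \<phi> (cldom t) = dom1 M m (clext M R \<phi> t) \<and>
       clext M R \<phi> (clcod t) = cod1 M m (clext M R \<phi> t))"

lemma clext_domn:
  assumes "\<And>k t. k \<le> j \<Longrightarrow> clcell k t \<Longrightarrow> clext_ok k t" "clcell j t"
  shows "domn M i j (clext M R \<phi> t) = clext M R \<phi> ((cldom ^^ (j - i)) t)"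
  using assms
proof (induction j arbitrary: t)
  case (Suc j)
  have "clext_ok (Suc j) t" using Suc.prems by blast
  moreover have "domn M i j (clext M R \<phi> (cldom t)) = clext M R \<phi> ((cldom ^^ (j - i)) (cldom t))"
  proof (rule Suc.IH)
    show "clext_ok k t" if "k \<le> j" "clcell k t" for k t
      using Suc.prems(1)[of k t] that by simp
    show "clcell j (cldom t)" using clcell_boundary[OF Suc.prems(2) refl] by simp
  qed
  ultimately show ?case
    by (simp add: clext_ok_def Suc_diff_le funpow_Suc_right del: funpow.simps)
qed simp

lemma clext_codn:
  assumes "\<And>k t. k \<le> j \<Longrightarrow> clcell k t \<Longrightarrow> clext_ok k t" "clcell j t"
  shows "codn M i j (clext M R \<phi> t) = clext M R \<phi> ((clcod ^^ (j - i)) t)"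
  using assms
proof (induction j arbitrary: t)
  case (Suc j)
  have "clext_ok (Suc j) t" using Suc.prems by blast
  moreover have "codn M i j (clext M R \<phi> (clcod t)) = clext M R \<phi> ((clcod ^^ (j - i)) (clcod t))"
  proof (rule Suc.IH)
    show "clext_ok k t" if "k \<le> j" "clcell k t" for k t
      using Suc.prems(1)[of k t] that by simp
    show "clcell j (clcod t)" using clcell_boundary[OF Suc.prems(2) refl] by simp
  qed
  ultimately show ?case
    by (simp add: clext_ok_def Suc_diff_le funpow_Suc_right del: funpow.simps)
qed simp

lemma clext_Brg:
  assumes "clext_ok k a" "clext_ok k b" "parallel Cl2 k a b"
  shows "(clext M R \<phi> a, clext M R \<phi> b, clext M R \<phi> (Brg a b)) \<in> R k"
proof -
  have "parallel M k (clext M R \<phi> a) (clext M R \<phi> b)"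
    using assms by (auto simp: parallel_def clext_ok_def)
  then have "\<exists>!c. (clext M R \<phi> a, clext M R \<phi> b, c) \<in> R k"
    using clique by (auto simp: omega_clique_def bridge_relation_def)
  from theI'[OF this] show ?thesis
    using assms(3) clcell_cldim[of k a] by (simp add: Cl2_parallel)
qed

lemma clext_composable:
  assumes "\<And>k t. k < j \<Longrightarrow> clcell k t \<Longrightarrow> clext_ok k t" "clext_ok j a" "clext_ok j b"
    "clcell j (Cmp i j a b)"
  shows "composable M i j (clext M R \<phi> a) (clext M R \<phi> b)"
proof -
  have ab: "clcell j a" "clcell j b" "i < j" "(clcod ^^ (j - i)) a = (cldom ^^ (j - i)) b"
    using assms(4) by (simp_all add: clcell_Cmp_iff)
  obtain m where m: "j = Suc m" using ab(3) by (cases j) simp_all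
  have IH: "\<And>k t. k \<le> m \<Longrightarrow> clcell k t \<Longrightarrow> clext_ok k t" using assms(1) m by simp
  have "clcell m (clcod a)" "clcell m (cldom b)"
    using clcell_boundary[OF ab(1) m] clcell_boundary[OF ab(2) m] by auto
  moreover have "j - i = Suc (m - i)" using ab(3) m by simp
  ultimately have "codn M i m (clext M R \<phi> (clcod a)) = domn M i m (clext M R \<phi> (cldom b))"
    using clext_codn[of m, OF IH, of "clcod a" i] clext_domn[of m, OF IH, of "cldom b" i] ab(4)
    by (simp add: funpow_Suc_right del: funpow.simps)
  then show ?thesis
    using ab(3) m assms(2,3) by (simp add: composable_def clext_ok_def)
qed

lemma clext_ok: "clcell k t \<Longrightarrow> clext_ok k t"
proof (induction k arbitrary: t rule: less_induct)
  case (less k)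
  note outer = less.IH
  have "clcell k' t \<Longrightarrow> k' = k \<Longrightarrow> clext_ok k' t" for k' t
  proof (induction rule: clcell.induct)
    case (Pt p)
    then have "p \<in> cells K2 0" by simp
    then have "\<phi> 0 p \<in> cells M 0"
      using \<phi> unfolding graph_morphism_def globular_morphism_def by blast
    then show ?case by (simp add: clext_ok_def)
  next
    case (Idc k' a)
    then have "clext_ok k' a" using outer[of k' a] by simp
    then show ?case
      using Idc.hyps by (simp add: clext_ok_def clcell_cldim id1_cell dom1_id1 cod1_id1)
  next
    case (Cmp i j a b)
    have ok: "clext_ok j a" "clext_ok j b" using Cmp.IH Cmp.prems by simp_all
    have c: "composable M i j (clext M R \<phi> a) (clext M R \<phi> b)"
    proof (rule clext_composable[OF _ ok])
      show "clext_ok k' t" if "k' < j" "clcell k' t" for k' t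
        using outer that Cmp.prems by blast
      show "clcell j (Cmp i j a b)" by (rule clcell.Cmp) (fact Cmp.hyps)+
    qed
    obtain m where m: "j = Suc m" using Cmp.hyps(1) by (cases j) simp_all
    show ?case
    proof (cases "i = m")
      case True
      then show ?thesis using c ok m
        by (simp add: clext_ok_def cmp_cell dom1_cmp_top cod1_cmp_top)
    next
      case False
      then have "i < m" using Cmp.hyps(1) m by simp
      then show ?thesis using c ok m False
        by (simp add: clext_ok_def cmp_cell dom1_cmp cod1_cmp)
    qed
  next
    case (Brg k' a b)
    then have ok: "clext_ok k' a" "clext_ok k' b" using outer[of k'] by simp_all
    have "(clext M R \<phi> a, clext M R \<phi> b, clext M R \<phi> (Brg a b)) \<in> R k'"
      by (rule clext_Brg[OF ok]) (use Brg.hyps in \<open>simp add: Cl2_parallel\<close>)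
    moreover have "bridge_relation M R" using clique by (simp add: omega_clique_def)
    ultimately have "clext M R \<phi> (Brg a b) \<in> cells M (Suc k') \<and>
        dom1 M k' (clext M R \<phi> (Brg a b)) = clext M R \<phi> a \<and>
        cod1 M k' (clext M R \<phi> (Brg a b)) = clext M R \<phi> b"
      unfolding bridge_relation_def by blast
    then show ?case
      by (simp add: clext_ok_def del: clext.simps)
  qed
  then show ?case using less.prems by blast
qed

theorem Cl2_extend:
  "\<exists>H. bridge_morphism Cl2 Cl2_bridges M R H \<and>
     (\<forall>k. \<forall>p\<in>cells K2 k. H k (K2_Cl2 k p) = \<phi> k p)"
proof (intro exI conjI)
  let ?H = "\<lambda>k. clext M R \<phi>"
  have R: "bridge_relation M R" using clique by (simp add: omega_clique_def)
  have "(clext M R \<phi> a, clext M R \<phi> b, clext M R \<phi> c) \<in> R k"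
    if "(a, b, c) \<in> Cl2_bridges k" for k a b c
  proof -
    have p: "parallel Cl2 k a b" and c: "c = (if a = b then Idc a else Brg a b)"
      using that by (auto simp: Cl2_bridges_def)
    have ok: "clext_ok k a" "clext_ok k b" using p by (auto simp: Cl2_parallel clext_ok)
    show ?thesis
    proof (cases "a = b")
      case True
      have "(clext M R \<phi> a, clext M R \<phi> a, id1 M k (clext M R \<phi> a)) \<in> R k"
        using R ok(1) unfolding bridge_relation_def clext_ok_def by blast
      moreover have "cldim a = k" using p by (simp add: Cl2_parallel clcell_cldim)
      ultimately show ?thesis using True c by simp
    next
      case False
      then show ?thesis using clext_Brg[OF ok p] c by (simp del: clext.simps)
    qed
  qed
  moreover have "globular_morphism Cl2 M ?H"
    unfolding globular_morphism_def
  proof (intro conjI allI ballI)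
    fix k t assume "t \<in> cells Cl2 k"
    then show "clext M R \<phi> t \<in> cells M k"
      using clext_ok[of k t] by (simp add: clext_ok_def)
  next
    fix k t assume "t \<in> cells Cl2 (Suc k)"
    then have "clext_ok (Suc k) t" by (simp add: clext_ok)
    then show "clext M R \<phi> (dom1 Cl2 k t) = dom1 M k (clext M R \<phi> t)"
      "clext M R \<phi> (cod1 Cl2 k t) = cod1 M k (clext M R \<phi> t)"
      by (simp_all add: clext_ok_def)
  qed
  ultimately show "bridge_morphism Cl2 Cl2_bridges M R ?H"
    by (simp add: bridge_morphism_def magma_morphism_def graph_morphism_def clcell_cldim)
  show "\<forall>k. \<forall>p\<in>cells K2 k. ?H k (K2_Cl2 k p) = \<phi> k p"
  proof (intro allI ballI)
    fix k p assume p: "p \<in> cells K2 k"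
    then have c: "clcell 0 (Pt p)" by (auto intro: clcell.Pt)
    show "?H k (K2_Cl2 k p) = \<phi> k p"
    proof (induction k)
      case (Suc k)
      have "p \<in> cells K2 k" using p by simp
      then have "\<phi> (Suc k) (id1 K2 k p) = id1 M k (\<phi> k p)"
        using \<phi> unfolding graph_morphism_def by blast
      then show ?case
        using Suc clcell_cldim[OF clcell_idn[OF c, of k]] by (simp add: K2_Cl2_def)
    qed (simp add: K2_Cl2_def)
  qed
qed

theorem Cl2_extend_unique:
  assumes H: "bridge_morphism Cl2 Cl2_bridges M R H"
      "\<forall>k. \<forall>p\<in>cells K2 k. H k (K2_Cl2 k p) = \<phi> k p"
    and H': "bridge_morphism Cl2 Cl2_bridges M R H'"
      "\<forall>k. \<forall>p\<in>cells K2 k. H' k (K2_Cl2 k p) = \<phi> k p"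
    and "t \<in> cells Cl2 k"
  shows "H k t = H' k t"
proof -
  have "clcell k t" using assms(5) by simp
  then show ?thesis
  proof induction
    case (Pt p)
    then have "p \<in> cells K2 0" by auto
    then have "H 0 (K2_Cl2 0 p) = H' 0 (K2_Cl2 0 p)" using H(2) H'(2) by simp
    then show ?case by (simp add: K2_Cl2_def)
  next
    case (Idc k a)
    then show ?case
      using H(1) H'(1) by (auto simp: bridge_morphism_def magma_morphism_def graph_morphism_def)
  next
    case (Cmp i j a b)
    then have "composable Cl2 i j a b" by (auto simp: Cl2_composable intro: clcell.Cmp)
    then show ?case
      using H(1) H'(1) Cmp by (auto simp: bridge_morphism_def magma_morphism_def)
  next
    case (Brg k a b)
    then have "(a, b, Brg a b) \<in> Cl2_bridges k" by (auto simp: Cl2_bridges_def Cl2_parallel)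
    then have "(H k a, H k b, H (Suc k) (Brg a b)) \<in> R k"
      "(H' k a, H' k b, H' (Suc k) (Brg a b)) \<in> R k"
      using H(1) H'(1) by (auto simp: bridge_morphism_def)
    moreover have "H k a = H' k a" "H k b = H' k b" using Brg by simp_all
    moreover have "bridge_relation M R" using clique by (simp add: omega_clique_def)
    ultimately show ?case unfolding bridge_relation_def by metis
  qed
qed

end

section \<open>Internal equivalences\<close>

definition hom_magma :: "'a omagma \<Rightarrow> nat \<Rightarrow> 'a \<Rightarrow> 'a \<Rightarrow> 'a omagma" where
  "hom_magma M k a b =
     \<lparr>cells = \<lambda>j. {c \<in> cells M (Suc k + j).
        domn M k (Suc k + j) c = a \<and> codn M k (Suc k + j) c = b},
      dom1 = \<lambda>j. dom1 M (Suc k + j),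
      cod1 = \<lambda>j. cod1 M (Suc k + j),
      id1 = \<lambda>j. id1 M (Suc k + j),
      cmp = \<lambda>i j. cmp M (Suc k + i) (Suc k + j)\<rparr>"

text \<open>
  A graded subset of \<open>M\<close> is a function from dimensions to sets of cells.
\<close>

definition elementary_equivalences :: "'a omagma \<Rightarrow> nat \<Rightarrow> 'a set" where
  "elementary_equivalences M k = {f \<in> cells M k.
     identity_cell M k f \<or>
     (k = 1 \<and> (\<exists>H. magma_morphism Cl2 M H \<and> H 1 (clc 1 2) = f)) \<or>
     (2 \<le> k \<and> (\<exists>H. magma_morphism Cl2
        (hom_magma M (k - 2) (domn M (k - 2) k f) (codn M (k - 2) k f)) H \<and>
        H 1 (clc 1 2) = f))}"

inductive in_composites :: "'a omagma \<Rightarrow> (nat \<Rightarrow> 'a set) \<Rightarrow> nat \<Rightarrow> 'a \<Rightarrow> bool"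
  for M :: "'a omagma" and S :: "nat \<Rightarrow> 'a set" where
  base: "x \<in> S k \<Longrightarrow> in_composites M S k x"
| step: "in_composites M S j a \<Longrightarrow> in_composites M S j b \<Longrightarrow> composable M i j a b \<Longrightarrow>
    in_composites M S j (cmp M i j a b)"

definition composites :: "'a omagma \<Rightarrow> (nat \<Rightarrow> 'a set) \<Rightarrow> nat \<Rightarrow> 'a set" where
  "composites M S k = {x. in_composites M S k x}"

definition weakly_invertible :: "'a omagma \<Rightarrow> (nat \<Rightarrow> 'a set) \<Rightarrow> nat \<Rightarrow> 'a set" where
  "weakly_invertible M S k = {f \<in> cells M k. \<exists>m. k = Suc m \<and>
     (\<exists>g\<in>cells M k. dom1 M m g = cod1 M m f \<and> cod1 M m g = dom1 M m f \<and>
       (\<exists>h\<in>S (Suc k). \<exists>h'\<in>S (Suc k).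
          dom1 M k h = cmp M m k f g \<and> cod1 M k h = id1 M m (dom1 M m f) \<and>
          dom1 M k h' = cmp M m k g f \<and> cod1 M k h' = id1 M m (cod1 M m f)))}"

text \<open>\<open>eq_stage M r\<close> is the stage with number \<open>r + 1\<close> of the usual numbering from one.\<close>

primrec eq_stage :: "'a omagma \<Rightarrow> nat \<Rightarrow> nat \<Rightarrow> 'a set" where
  "eq_stage M 0 = composites M (elementary_equivalences M)"
| "eq_stage M (Suc r) =
     composites M (\<lambda>k. eq_stage M r k \<union> weakly_invertible M (eq_stage M r) k)"

definition internal_equivalences :: "'a omagma \<Rightarrow> nat \<Rightarrow> 'a set" where
  "internal_equivalences M k = (\<Union>r. eq_stage M r k)"

definition tame ::
    "('a1, 'a2, 'a3) weak_ocat \<Rightarrow> ('b1, 'b2, 'b3) weak_ocat \<Rightarrow>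
     ('a1, 'a2, 'a3, 'b1, 'b2, 'b3) pseudofun \<Rightarrow> bool" where
  "tame X Y F \<longleftrightarrow>
     (\<forall>k. fun1 F k ` internal_equivalences (mag1 X) k \<subseteq> internal_equivalences (mag1 Y) k)"

end

theory Submission
  imports Defs
begin

text \<open>
  Whether a cell is an internal equivalence depends on cells one dimension higher, so the proof
  descends on the dimension. Above \<open>n\<close> there is nothing to do: every cell of the underlying magma
  of \<open>Y\<close> is an identity there, and identities are elementary equivalences. For the descent from
  \<open>k + 1\<close> to \<open>k\<close>, take an internal equivalence \<open>f\<close> of dimension \<open>k\<close> in \<open>X\<close>. It has a quasi-inverse
  \<open>g\<close>: the composites \<open>f g\<close> and \<open>g f\<close> are joined to identities by internal equivalences of dimension
  \<open>k + 1\<close> (\<open>internal_equivalence_quasi_inverse\<close>), which \<open>F\<close> maps to internal equivalences by the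
  induction hypothesis. They join \<open>F (f g)\<close> to \<open>F id\<close> instead of \<open>(F f) (F g)\<close> to \<open>id\<close>, but a
  pseudo-functor makes the lifts of these cells to the middle magma agree after \<open>kappa\<close>, so bridges
  correct both ends. Hence \<open>F g\<close> is a quasi-inverse of \<open>F f\<close>, and a cell with a quasi-inverse is an
  internal equivalence.

  Two facts carry this. First, a bridge is the image of the generating \<open>1\<close>-cell of \<open>Cl(2)\<close>: the cells
  of the middle magma with a fixed lower boundary that \<open>kappa\<close> sends to the iterated identities of one
  cell form an omega clique, and the universal property of \<open>Cl(2)\<close> applies to it
  (\<open>Penon_bridge_from_Cl2\<close>). So all
  coherence cells that bridges provide are elementary equivalences (\<open>coherent_equivalent\<close>). Second,
  the cells with a quasi-inverse contain all generators of the internal equivalences and are closed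
  under composition. For composites this is the usual calculation with associativity, units and
  interchange, each valid up to a coherence cell. For an elementary equivalence the inverse is the
  image of the opposite generator of \<open>Cl(2)\<close>; the cells relating the composites to identities are
  bridges of \<open>Cl(2)\<close>, and the first fact covers them because \<open>Cl(2)\<close> is itself a clique, hence Penon
  over the terminal strict omega category.
\<close>

section \<open>Iterated boundaries\<close>

context globular_set
begin

lemma domn_cod1: "i < j \<Longrightarrow> x \<in> cells X (Suc j) \<Longrightarrow> domn X i j (cod1 X j x) = domn X i j (dom1 X j x)"
  by (cases j) (auto simp: dom1_dom1)

lemma codn_dom1: "i < j \<Longrightarrow> x \<in> cells X (Suc j) \<Longrightarrow> codn X i j (dom1 X j x) = codn X i j (cod1 X j x)"
  by (cases j) (auto simp: cod1_cod1)

end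

lemma domn_trivial [simp]: "j \<le> i \<Longrightarrow> domn X i j x = x"
  by (cases j) auto

lemma codn_trivial [simp]: "j \<le> i \<Longrightarrow> codn X i j x = x"
  by (cases j) auto

lemma idn_trivial [simp]: "j \<le> i \<Longrightarrow> idn X i j x = x"
  by (cases j) auto

lemma composable_top [simp]:
  "composable M i (Suc i) a b \<longleftrightarrow>
     a \<in> cells M (Suc i) \<and> b \<in> cells M (Suc i) \<and> cod1 M i a = dom1 M i b"
  by (auto simp: composable_def)

context omega_graph
begin

lemma idn_cell: "x \<in> cells X i \<Longrightarrow> i \<le> j \<Longrightarrow> idn X i j x \<in> cells X j"
  by (induction j) (auto simp: id1_cell le_Suc_eq)

lemma domn_idn:
  "x \<in> cells X d \<Longrightarrow> d \<le> i \<Longrightarrow> i \<le> j \<Longrightarrow> domn X i j (idn X d j x) = idn X d i x"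
  by (induction j) (auto simp: dom1_id1 idn_cell le_Suc_eq)

end

lemma idn_idn: "d \<le> i \<Longrightarrow> i \<le> j \<Longrightarrow> idn X i j (idn X d i x) = idn X d j x"
  by (induction j) (auto simp: le_Suc_eq)

context omega_magma
begin

lemma composable_dom1:
  "i < m \<Longrightarrow> composable M i (Suc m) a b \<Longrightarrow> composable M i m (dom1 M m a) (dom1 M m b)"
  by (auto simp: composable_def dom1_cell codn_dom1)

lemma composable_cod1:
  "i < m \<Longrightarrow> composable M i (Suc m) a b \<Longrightarrow> composable M i m (cod1 M m a) (cod1 M m b)"
  by (auto simp: composable_def cod1_cell domn_cod1)

lemma composable_id1:
  "composable M i m a b \<Longrightarrow> composable M i (Suc m) (id1 M m a) (id1 M m b)"
  by (auto simp: composable_def id1_cell dom1_id1 cod1_id1)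

lemma domn_cmp_below:
  "composable M i j a b \<Longrightarrow> k \<le> i \<Longrightarrow> domn M k j (cmp M i j a b) = domn M k j a"
proof (induction j arbitrary: a b)
  case (Suc m)
  then have "i \<le> m" by (auto simp: composable_def)
  show ?case
  proof (cases "i = m")
    case True
    then show ?thesis using Suc.prems dom1_cmp_top[of i a b] by simp
  next
    case False
    with \<open>i \<le> m\<close> have "i < m" by simp
    from Suc.IH[OF composable_dom1[OF this Suc.prems(1)] Suc.prems(2)]
    show ?thesis using dom1_cmp[OF \<open>i < m\<close> Suc.prems(1)] Suc.prems(2) \<open>i < m\<close> by simp
  qed
qed (simp add: composable_def)

lemma codn_cmp_below:
  "composable M i j a b \<Longrightarrow> k \<le> i \<Longrightarrow> codn M k j (cmp M i j a b) = codn M k j b"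
proof (induction j arbitrary: a b)
  case (Suc m)
  then have "i \<le> m" by (auto simp: composable_def)
  show ?case
  proof (cases "i = m")
    case True
    then show ?thesis using Suc.prems cod1_cmp_top[of i a b] by simp
  next
    case False
    with \<open>i \<le> m\<close> have "i < m" by simp
    from Suc.IH[OF composable_cod1[OF this Suc.prems(1)] Suc.prems(2)]
    show ?thesis using cod1_cmp[OF \<open>i < m\<close> Suc.prems(1)] Suc.prems(2) \<open>i < m\<close> by simp
  qed
qed (simp add: composable_def)

end

section \<open>Morphisms\<close>

lemma globular_domn:
  "globular_morphism X Y F \<Longrightarrow> globular_set X \<Longrightarrow> x \<in> cells X j \<Longrightarrow> i \<le> j \<Longrightarrow>
    F i (domn X i j x) = domn Y i j (F j x)"
proof (induction j arbitrary: x)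
  case (Suc j)
  then show ?case
    by (cases "i \<le> j") (auto simp: globular_morphism_def globular_set.dom1_cell le_Suc_eq)
qed auto

lemma globular_codn:
  "globular_morphism X Y F \<Longrightarrow> globular_set X \<Longrightarrow> x \<in> cells X j \<Longrightarrow> i \<le> j \<Longrightarrow>
    F i (codn X i j x) = codn Y i j (F j x)"
proof (induction j arbitrary: x)
  case (Suc j)
  then show ?case
    by (cases "i \<le> j") (auto simp: globular_morphism_def globular_set.cod1_cell le_Suc_eq)
qed auto

lemma globular_composable:
  assumes "globular_morphism X Y F" "globular_set X" "composable X i j a b"
  shows "composable Y i j (F j a) (F j b)"
  using assms globular_codn[OF assms(1,2), of a j i] globular_domn[OF assms(1,2), of b j i]
  by (auto simp: composable_def globular_morphism_def)

lemma graph_morphismD: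
  assumes "graph_morphism X Y F"
  shows "globular_morphism X Y F"
    and "x \<in> cells X k \<Longrightarrow> F k x \<in> cells Y k"
    and "x \<in> cells X (Suc k) \<Longrightarrow> dom1 Y k (F (Suc k) x) = F k (dom1 X k x)"
    and "x \<in> cells X (Suc k) \<Longrightarrow> cod1 Y k (F (Suc k) x) = F k (cod1 X k x)"
    and "x \<in> cells X k \<Longrightarrow> F (Suc k) (id1 X k x) = id1 Y k (F k x)"
  using assms by (simp_all add: graph_morphism_def globular_morphism_def)

lemma magma_morphismD:
  assumes "magma_morphism X Y F"
  shows "graph_morphism X Y F"
    and "composable X i j a b \<Longrightarrow> F j (cmp X i j a b) = cmp Y i j (F j a) (F j b)"
  using assms by (simp_all add: magma_morphism_def)

lemma magma_morphism_comp:
  assumes F: "magma_morphism X Y F" and G: "magma_morphism Y Z G" and X: "omega_magma X"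
  shows "magma_morphism X Z (\<lambda>k. G k \<circ> F k)"
proof -
  interpret omega_magma X by (fact X)
  have g: "globular_morphism X Y F"
    using F by (simp add: magma_morphism_def graph_morphism_def)
  note globular_composable[OF g globular_set_axioms]
  with F G show ?thesis
    by (auto simp: magma_morphism_def graph_morphism_def globular_morphism_def dom1_cell cod1_cell id1_cell)
qed

section \<open>Cells of high dimension as a magma\<close>

text \<open>
  A family \<open>C\<close> of cells of dimension at least \<open>d\<close>, renumbered so that \<open>d\<close>-cells become \<open>0\<close>-cells. Magmas
  of this form cover hom-magmas, the magma itself (\<open>d = 0\<close>) and the fibres of a Penon morphism, and
  slices of slices are again slices.
\<close>

definition slice :: "'a omagma \<Rightarrow> nat \<Rightarrow> (nat \<Rightarrow> 'a set) \<Rightarrow> 'a omagma" where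
  "slice M d C = \<lparr>cells = C,
      dom1 = \<lambda>j. dom1 M (d + j),
      cod1 = \<lambda>j. cod1 M (d + j),
      id1 = \<lambda>j. id1 M (d + j),
      cmp = \<lambda>i j. cmp M (d + i) (d + j)\<rparr>"

abbreviation shift :: "'a omagma \<Rightarrow> nat \<Rightarrow> 'a omagma" where
  "shift M d \<equiv> slice M d (\<lambda>j. cells M (d + j))"

lemma slice_simps [simp]:
  "cells (slice M d C) = C" "dom1 (slice M d C) j = dom1 M (d + j)"
  "cod1 (slice M d C) j = cod1 M (d + j)" "id1 (slice M d C) j = id1 M (d + j)"
  "cmp (slice M d C) i j = cmp M (d + i) (d + j)"
  by (simp_all add: slice_def)

lemma domn_slice [simp]: "domn (slice M d C) i j x = domn M (d + i) (d + j) x"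
  by (induction j arbitrary: x) (auto simp: not_le)

lemma codn_slice [simp]: "codn (slice M d C) i j x = codn M (d + i) (d + j) x"
  by (induction j arbitrary: x) (auto simp: not_le)

lemma composable_slice:
  "composable (slice M d C) i j a b \<Longrightarrow> C j \<subseteq> cells M (d + j) \<Longrightarrow>
    composable M (d + i) (d + j) a b"
  by (auto simp: composable_def)

lemma shift_0 [simp]: "slice M 0 (cells M) = M"
  by (cases M) (simp add: slice_def)

lemma slice_slice [simp]: "slice (slice M d C) e D = slice M (d + e) D"
  by (simp add: slice_def add.assoc)

lemma hom_magma_slice:
  "hom_magma M k a b = slice M (Suc k) (\<lambda>j. {c \<in> cells M (Suc k + j).
     domn M k (Suc k + j) c = a \<and> codn M k (Suc k + j) c = b})"
  by (simp add: hom_magma_def slice_def)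

lemma slice_omega_magma:
  assumes M: "omega_magma M" and C: "\<And>j. C j \<subseteq> cells M (d + j)"
    and "\<And>j x. x \<in> C (Suc j) \<Longrightarrow> dom1 M (d + j) x \<in> C j"
    and "\<And>j x. x \<in> C (Suc j) \<Longrightarrow> cod1 M (d + j) x \<in> C j"
    and "\<And>j x. x \<in> C j \<Longrightarrow> id1 M (d + j) x \<in> C (Suc j)"
    and "\<And>i j a b. a \<in> C j \<Longrightarrow> b \<in> C j \<Longrightarrow> composable M (d + i) (d + j) a b \<Longrightarrow>
      cmp M (d + i) (d + j) a b \<in> C j"
  shows "omega_magma (slice M d C)"
proof -
  interpret omega_magma M by (fact M)
  note c = composable_slice[OF _ C]
  have C': "x \<in> cells M (d + j)" if "x \<in> C j" for j x using C that by blast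
  show ?thesis
  proof unfold_locales
    fix i j a b assume "composable (slice M d C) i j a b"
    with c[OF this] assms(6) show "cmp (slice M d C) i j a b \<in> cells (slice M d C) j"
      by (auto simp: composable_def)
  next
    fix i a b assume "composable (slice M d C) i (Suc i) a b"
    from c[OF this]
    show "dom1 (slice M d C) i (cmp (slice M d C) i (Suc i) a b) = dom1 (slice M d C) i a"
      "cod1 (slice M d C) i (cmp (slice M d C) i (Suc i) a b) = cod1 (slice M d C) i b"
      using dom1_cmp_top[of "d + i"] cod1_cmp_top[of "d + i"] by simp_all
  next
    fix i m a b assume "i < m" "composable (slice M d C) i (Suc m) a b"
    with c[OF this(2)]
    show "dom1 (slice M d C) m (cmp (slice M d C) i (Suc m) a b) =
        cmp (slice M d C) i m (dom1 (slice M d C) m a) (dom1 (slice M d C) m b)"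
      "cod1 (slice M d C) m (cmp (slice M d C) i (Suc m) a b) =
        cmp (slice M d C) i m (cod1 (slice M d C) m a) (cod1 (slice M d C) m b)"
      using dom1_cmp[of "d + i" "d + m"] cod1_cmp[of "d + i" "d + m"] by simp_all
  qed (use assms(3-5) C' in \<open>auto simp: dom1_cell cod1_cell id1_cell dom1_id1 cod1_id1
        dest!: C' intro!: dom1_dom1 cod1_cod1\<close>)
qed

lemma magma_morphism_shift:
  "magma_morphism X Y F \<Longrightarrow> magma_morphism (shift X d) (shift Y d) (\<lambda>j. F (d + j))"
  using composable_slice[of X d "\<lambda>j. cells X (d + j)"]
  by (auto simp: magma_morphism_def graph_morphism_def globular_morphism_def)

lemma magma_morphism_slice:
  "magma_morphism X (slice M d C) F \<Longrightarrow> (\<And>j. C j \<subseteq> cells M (d + j)) \<Longrightarrow>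
    magma_morphism X (shift M d) F"
  unfolding magma_morphism_def graph_morphism_def globular_morphism_def
  by auto

lemma shift_omega_magma:
  assumes "omega_magma M" shows "omega_magma (shift M d)"
proof -
  interpret omega_magma M by (fact assms)
  show ?thesis
    by (rule slice_omega_magma[OF assms]) (auto simp: dom1_cell cod1_cell id1_cell cmp_cell)
qed

section \<open>Elementary equivalences and free cliques\<close>

lemma clcell_0_iff: "clcell 0 t \<longleftrightarrow> t = Pt 1 \<or> t = Pt 2"
  by (subst clcell.simps) auto

lemma clcell_bridge_points: "clcell (Suc 0) (Brg (Pt 1) (Pt 2))" "clcell (Suc 0) (Brg (Pt 2) (Pt 1))"
  by (auto intro!: clcell.intros)

text \<open>
  The boundary condition in \<^const>\<open>hom_magma\<close> is automatic: the images of the two points are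
  parallel because the image of the \<open>1\<close>-cell between them is a cell of \<open>M\<close>, and all higher cells
  inherit the boundary from the points. This replaces the case distinction in the definition of
  elementary equivalences by a condition that is uniform in the dimension.
\<close>

lemma elementary_equivalence_image:
  assumes M: "omega_magma M" and H: "magma_morphism Cl2 (shift M d) H"
  shows "H 1 (clc 1 2) \<in> elementary_equivalences M (Suc d)"
proof -
  interpret omega_magma M by (fact M)
  interpret shift: omega_magma "shift M d" by (rule shift_omega_magma[OF M])
  let ?f = "H 1 (clc 1 2)"
  have g: "globular_morphism Cl2 (shift M d) H"
    using H by (simp add: magma_morphism_def graph_morphism_def)
  have cell: "H j t \<in> cells M (d + j)" if "clcell j t" for j t
    using g that by (simp add: globular_morphism_def)
  have dom: "dom1 M (d + j) (H (Suc j) t) = H j (cldom t)"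
    and cod: "cod1 M (d + j) (H (Suc j) t) = H j (clcod t)" if "clcell (Suc j) t" for j t
    using g that by (simp_all add: globular_morphism_def)
  have c: "clcell (Suc 0) (clc 1 2)" "cldom (clc 1 2) = Pt 1" "clcod (clc 1 2) = Pt 2"
    using clcell_bridge_points by (simp_all add: clc_neq)
  note f = dom[OF c(1), unfolded c, simplified] cod[OF c(1), unfolded c, simplified]
    cell[OF c(1), simplified]
  show ?thesis
  proof (cases d)
    case 0
    then show ?thesis
      using H f by (auto simp: elementary_equivalences_def)
  next
    case (Suc k)
    let ?a = "domn M k (Suc d) ?f" and ?b = "codn M k (Suc d) ?f"
    have "domn M k (d + j) (H j t) = ?a \<and> codn M k (d + j) (H j t) = ?b" if "clcell j t" for j t
      using that
    proof (induction j arbitrary: t)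
      case 0
      then show ?case
        using f Suc dom1_dom1[of ?f k] cod1_cod1[of ?f k] by (auto simp: clcell_0_iff)
    next
      case (Suc j)
      then have "clcell j (cldom t)" "clcell j (clcod t)"
        using clcell_boundary[OF Suc.prems refl] by simp_all
      then show ?case using Suc dom[OF Suc.prems] cod[OF Suc.prems] \<open>d = Suc k\<close> by simp
    qed
    then have "magma_morphism Cl2 (hom_magma M k ?a ?b) H"
      using H Suc
      by (auto simp: hom_magma_slice magma_morphism_def graph_morphism_def globular_morphism_def)
    then show ?thesis
      using f Suc by (auto simp: elementary_equivalences_def)
  qed
qed

lemma elementary_equivalence_cases:
  assumes "f \<in> elementary_equivalences M (Suc d)"
  obtains "identity_cell M (Suc d) f"
  | H where "magma_morphism Cl2 (shift M d) H" "H 1 (clc 1 2) = f"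
proof (cases d)
  case 0
  then show ?thesis
    using assms that by (auto simp: elementary_equivalences_def)
next
  case (Suc k)
  have "magma_morphism Cl2 (shift M (Suc k)) H"
    if "magma_morphism Cl2 (hom_magma M k a b) H" for a b H
    using that unfolding hom_magma_slice by (rule magma_morphism_slice) blast
  then show ?thesis
    using assms that Suc by (auto simp: elementary_equivalences_def)
qed

lemma (in strict_omega_category) cmp_idn:
  assumes "d \<le> i" "i < j" "z \<in> cells M d"
  shows "cmp M i j (idn M d j z) (idn M d j z) = idn M d j z"
  using cmp_unit_left[OF assms(2), of "idn M d j z"] assms
  by (simp add: idn_cell domn_idn idn_idn)

text \<open>
  Cells with the same image under \<open>\<kappa>\<close> are bridged as soon as they are parallel. The cells over the
  iterated identities of \<open>\<kappa> a\<close> whose boundary below dimension \<open>d\<close> is that of \<open>a\<close> therefore form a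
  clique, in which \<open>a\<close> and \<open>b\<close> are points. It is closed under composition because in a strict omega
  category an identity composed with itself is itself. The morphism from \<open>Cl(2)\<close> that picks out \<open>a\<close>
  and \<open>b\<close> preserves bridges, and bridges are unique, so it sends the generator to \<open>c\<close>.
\<close>

lemma Penon_bridge_from_Cl2:
  assumes P: "categorical_Penon_morphism X R Y S \<kappa>" and abc: "(a, b, c) \<in> R d"
  obtains H where "magma_morphism Cl2 (shift X d) H" "H 1 (clc 1 2) = c"
proof -
  interpret X: omega_magma X using P by (simp add: categorical_Penon_morphism_def)
  interpret Y: strict_omega_category Y using P by (simp add: categorical_Penon_morphism_def)
  have R: "bridge_relation X R" using P by (simp add: categorical_Penon_morphism_def)
  have mor: "magma_morphism X Y \<kappa>"
    using P by (simp add: categorical_Penon_morphism_def bridge_morphism_def)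
  then have gmor: "globular_morphism X Y \<kappa>" by (simp add: magma_morphism_def graph_morphism_def)
  have \<kappa>R: "\<kappa> k x = \<kappa> k y" "\<kappa> (Suc k) z = id1 Y k (\<kappa> k x)" if "(x, y, z) \<in> R k" for k x y z
    using P that unfolding categorical_Penon_morphism_def by blast+
  have fill: "\<exists>z. (x, y, z) \<in> R k" if "parallel X k x y" "\<kappa> k x = \<kappa> k y" for k x y
    using P that unfolding categorical_Penon_morphism_def by blast
  have R_cell: "x \<in> cells X k" "y \<in> cells X k" "z \<in> cells X (Suc k)" "parallel X k x y"
      "dom1 X k z = x" "cod1 X k z = y" if "(x, y, z) \<in> R k" for k x y z
    using R that unfolding bridge_relation_def by blast+
  \<comment> \<open>Boundaries are fixed strictly below dimension \<open>d\<close> only; this makes the \<open>0\<close>-cells of the slice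
    pairwise parallel in \<open>X\<close>, as they must be for bridges between them to exist.\<close>
  define C where "C j = {x \<in> cells X (d + j). \<kappa> (d + j) x = idn Y d (d + j) (\<kappa> d a) \<and>
      (\<forall>k. d = Suc k \<longrightarrow> domn X k (d + j) x = dom1 X k a \<and> codn X k (d + j) x = cod1 X k a)}" for j
  define T where "T j = {(x, y, z). (x, y, z) \<in> R (d + j) \<and> x \<in> C j \<and> y \<in> C j}" for j
  let ?Q = "slice X d C"
  have za: "\<kappa> d a \<in> cells Y d"
    using gmor R_cell[OF abc] by (simp add: globular_morphism_def)
  have \<kappa>dom: "\<kappa> k (dom1 X k x) = dom1 Y k (\<kappa> (Suc k) x)"
     "\<kappa> k (cod1 X k x) = cod1 Y k (\<kappa> (Suc k) x)" if "x \<in> cells X (Suc k)" for k x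
    using gmor that by (simp_all add: globular_morphism_def)
  have \<kappa>id: "\<kappa> (Suc k) (id1 X k x) = id1 Y k (\<kappa> k x)" if "x \<in> cells X k" for k x
    using mor that by (simp add: magma_morphism_def graph_morphism_def)
  have \<kappa>cmp: "\<kappa> j (cmp X i j x y) = cmp Y i j (\<kappa> j x) (\<kappa> j y)" if "composable X i j x y" for i j x y
    using mor that by (simp add: magma_morphism_def)
  have idY: "dom1 Y (d + j) (id1 Y (d + j) (idn Y d (d + j) (\<kappa> d a))) = idn Y d (d + j) (\<kappa> d a)"
    "cod1 Y (d + j) (id1 Y (d + j) (idn Y d (d + j) (\<kappa> d a))) = idn Y d (d + j) (\<kappa> d a)" for j
    using za by (simp_all add: Y.idn_cell Y.dom1_id1 Y.cod1_id1)
  have ab: "a \<in> C 0" "b \<in> C 0"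
    using R_cell[OF abc] \<kappa>R[OF abc] by (auto simp: C_def parallel_def)
  have Q: "omega_magma ?Q"
  proof (rule slice_omega_magma[OF X.omega_magma_axioms])
    show "C j \<subseteq> cells X (d + j)" for j by (auto simp: C_def)
    show "dom1 X (d + j) x \<in> C j" if "x \<in> C (Suc j)" for j x
    proof -
      have "domn X k (d + j) (dom1 X (d + j) x) = domn X k (d + Suc j) x"
        "codn X k (d + j) (dom1 X (d + j) x) = codn X k (d + Suc j) x" if "d = Suc k" for k
        using that \<open>x \<in> C (Suc j)\<close> X.codn_dom1[of k "d + j" x] by (simp_all add: C_def)
      then show ?thesis using that by (auto simp: C_def \<kappa>dom X.dom1_cell idY)
    qed
    show "cod1 X (d + j) x \<in> C j" if "x \<in> C (Suc j)" for j x
    proof -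
      have "codn X k (d + j) (cod1 X (d + j) x) = codn X k (d + Suc j) x"
        "domn X k (d + j) (cod1 X (d + j) x) = domn X k (d + Suc j) x" if "d = Suc k" for k
        using that \<open>x \<in> C (Suc j)\<close> X.domn_cod1[of k "d + j" x] by (simp_all add: C_def)
      then show ?thesis using that by (auto simp: C_def \<kappa>dom X.cod1_cell idY)
    qed
    show "id1 X (d + j) x \<in> C (Suc j)" if "x \<in> C j" for j x
      using that by (auto simp: C_def \<kappa>id X.id1_cell X.dom1_id1 X.cod1_id1)
    show "cmp X (d + i) (d + j) x y \<in> C j"
      if "x \<in> C j" "y \<in> C j" "composable X (d + i) (d + j) x y" for i j x y
    proof -
      have "i < j" using that(3) by (simp add: composable_def)
      moreover have "domn X k (d + j) (cmp X (d + i) (d + j) x y) = domn X k (d + j) x"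
        "codn X k (d + j) (cmp X (d + i) (d + j) x y) = codn X k (d + j) y" if "d = Suc k" for k
        using X.domn_cmp_below[OF \<open>composable X _ _ x y\<close>, of k]
          X.codn_cmp_below[OF \<open>composable X _ _ x y\<close>, of k] that by simp_all
      ultimately show ?thesis
        using that za by (auto simp: C_def \<kappa>cmp X.cmp_cell Y.cmp_idn)
    qed
  qed
  have "bridge_relation ?Q T"
    unfolding bridge_relation_def
  proof (intro conjI allI impI ballI)
    fix j x y z assume "(x, y, z) \<in> T j"
    then have T: "(x, y, z) \<in> R (d + j)" "x \<in> C j" "y \<in> C j" by (auto simp: T_def)
    then show "x \<in> cells ?Q j" "y \<in> cells ?Q j" "dom1 ?Q j z = x" "cod1 ?Q j z = y"
      by (simp_all add: R_cell)
    show "z \<in> cells ?Q (Suc j)"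
      using R_cell[OF T(1)] \<kappa>R[OF T(1)] T(2,3) by (auto simp: C_def)
    show "parallel ?Q j x y"
      using R_cell(4)[OF T(1)] T(2,3) by (auto simp: parallel_def)
  next
    fix j x assume "x \<in> cells ?Q j"
    then show "(x, x, id1 ?Q j x) \<in> T j"
      using R by (auto simp: T_def C_def bridge_relation_def)
  next
    fix j x y z z' assume "(x, y, z) \<in> T j" "(x, y, z') \<in> T j"
    then have "(x, y, z) \<in> R (d + j)" "(x, y, z') \<in> R (d + j)" by (simp_all add: T_def)
    then show "z = z'" using R unfolding bridge_relation_def by blast
  qed
  moreover have "\<exists>z. (x, y, z) \<in> T j" if Q: "parallel ?Q j x y" for j x y
  proof -
    have xy: "x \<in> C j" "y \<in> C j" using Q by (simp_all add: parallel_def)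
    moreover have "parallel X (d + j) x y"
    proof (cases j)
      case 0
      then show ?thesis using xy by (auto simp: parallel_def C_def)
    next
      case (Suc i)
      then show ?thesis using Q xy by (auto simp: parallel_def C_def)
    qed
    ultimately show ?thesis using fill[of "d + j" x y] by (auto simp: T_def C_def)
  qed
  ultimately have clique: "omega_clique ?Q T" using Q by (simp add: omega_clique_def)
  interpret Q: omega_magma ?Q by (fact Q)
  let ?\<phi> = "\<lambda>j p. idn ?Q 0 j (if p = 1 then a else b)"
  have "idn ?Q 0 j x \<in> C j" if "x \<in> C 0" for j x
    using Q.idn_cell[of x 0 j] that by simp
  then have "graph_morphism K2 ?Q ?\<phi>"
    using ab Q.dom1_id1 Q.cod1_id1 by (auto simp: graph_morphism_def globular_morphism_def)
  from Cl2_extend[OF clique this] obtain H where H: "bridge_morphism Cl2 Cl2_bridges ?Q T H"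
    "\<And>k p. p \<in> cells K2 k \<Longrightarrow> H k (K2_Cl2 k p) = ?\<phi> k p" by blast
  show ?thesis
  proof
    have "magma_morphism Cl2 ?Q H" using H(1) by (simp add: bridge_morphism_def)
    then show "magma_morphism Cl2 (shift X d) H"
      by (rule magma_morphism_slice) (auto simp: C_def)
    have "(Pt 1, Pt 2, clc 1 2) \<in> Cl2_bridges 0"
      by (auto simp: Cl2_bridges_def Cl2_parallel clcell_0_iff clc_neq)
    then have "(H 0 (Pt 1), H 0 (Pt 2), H 1 (clc 1 2)) \<in> T 0"
      using H(1) by (simp add: bridge_morphism_def)
    moreover have "H 0 (Pt 1) = a" "H 0 (Pt 2) = b"
      using H(2)[of 1 0] H(2)[of 2 0] by (simp_all add: K2_Cl2_def)
    ultimately have "(a, b, H 1 (clc 1 2)) \<in> R d" by (simp add: T_def)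
    then show "H 1 (clc 1 2) = c" using abc R unfolding bridge_relation_def by blast
  qed
qed

text \<open>
  The target of the Penon morphism by which the results on bridges apply to \<^const>\<open>Cl2\<close> itself.
\<close>

definition terminal_magma :: "unit omagma" where
  "terminal_magma = \<lparr>cells = \<lambda>_. UNIV, dom1 = \<lambda>_ x. x, cod1 = \<lambda>_ x. x, id1 = \<lambda>_ x. x,
     cmp = \<lambda>_ _ x _. x\<rparr>"

lemma Cl2_Penon_morphism:
  "categorical_Penon_morphism Cl2 Cl2_bridges terminal_magma (diagonal_bridges terminal_magma)
     (\<lambda>_ _. ())"
proof -
  have "strict_omega_category terminal_magma"
    by unfold_locales (auto simp: terminal_magma_def)
  then show ?thesis
    using Cl2_omega_clique
    by (auto simp: categorical_Penon_morphism_def omega_clique_def bridge_morphism_def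
        magma_morphism_def graph_morphism_def globular_morphism_def diagonal_bridges_def
        terminal_magma_def)
qed

text \<open>
  The shift \<open>d\<close> serves the two uses: \<open>d = 0\<close> for \<open>\<lambda>\<close> on the bridges of a weak omega category, and
  arbitrary \<open>d\<close> for the morphisms out of \<open>Cl(2)\<close> that witness elementary equivalences.
\<close>

lemma Penon_bridge_elementary:
  assumes P: "categorical_Penon_morphism X R Y S \<kappa>" and M: "omega_magma M"
    and G: "magma_morphism X (shift M d) G" and "(a, b, c) \<in> R k"
  shows "G (Suc k) c \<in> elementary_equivalences M (Suc (d + k))"
proof -
  obtain H where H: "magma_morphism Cl2 (shift X k) H" "H 1 (clc 1 2) = c"
    using Penon_bridge_from_Cl2[OF P assms(4)] .
  have "magma_morphism (shift X k) (shift M (d + k)) (\<lambda>j. G (k + j))"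
    using magma_morphism_shift[OF G, of k] by (simp add: add.assoc)
  from elementary_equivalence_image[OF M magma_morphism_comp[OF H(1) this Cl2_omega_magma]] H(2)
  show ?thesis by simp
qed

section \<open>Closure properties of internal equivalences\<close>

lemma eq_stage_mono: "r \<le> s \<Longrightarrow> eq_stage M r k \<subseteq> eq_stage M s k"
  by (rule lift_Suc_mono_le) (auto simp: composites_def intro: in_composites.base)

lemma elementary_equivalences_internal:
  "f \<in> elementary_equivalences M k \<Longrightarrow> f \<in> internal_equivalences M k"
  by (auto simp: internal_equivalences_def composites_def intro!: exI[of _ 0] in_composites.base)

lemma internal_equivalences_cmp:
  assumes "a \<in> internal_equivalences M j" "b \<in> internal_equivalences M j" "composable M i j a b"
  shows "cmp M i j a b \<in> internal_equivalences M j"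
proof -
  obtain r s where "a \<in> eq_stage M r j" "b \<in> eq_stage M s j"
    using assms by (auto simp: internal_equivalences_def)
  then have "a \<in> eq_stage M (max r s) j" "b \<in> eq_stage M (max r s) j"
    using eq_stage_mono[of r "max r s" M j] eq_stage_mono[of s "max r s" M j] by auto
  then have "cmp M i j a b \<in> eq_stage M (max r s) j"
    using assms(3) by (cases "max r s") (auto simp: composites_def intro: in_composites.step)
  then show ?thesis by (auto simp: internal_equivalences_def)
qed

text \<open>
  The two witnesses occur at possibly different stages; the later of both stages contains them.
\<close>

lemma weakly_invertible_internal:
  assumes "f \<in> weakly_invertible M (internal_equivalences M) k"
  shows "f \<in> internal_equivalences M k"
proof -
  obtain m g h h' where f: "f \<in> cells M k" "k = Suc m" "g \<in> cells M k"
      "dom1 M m g = cod1 M m f" "cod1 M m g = dom1 M m f"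
      "h \<in> internal_equivalences M (Suc k)" "h' \<in> internal_equivalences M (Suc k)"
      "dom1 M k h = cmp M m k f g" "cod1 M k h = id1 M m (dom1 M m f)"
      "dom1 M k h' = cmp M m k g f" "cod1 M k h' = id1 M m (cod1 M m f)"
    using assms unfolding weakly_invertible_def by blast
  then obtain r s where "h \<in> eq_stage M r (Suc k)" "h' \<in> eq_stage M s (Suc k)"
    by (auto simp: internal_equivalences_def)
  then have "h \<in> eq_stage M (max r s) (Suc k)" "h' \<in> eq_stage M (max r s) (Suc k)"
    using eq_stage_mono[of r "max r s" M "Suc k"] eq_stage_mono[of s "max r s" M "Suc k"] by auto
  with f have "f \<in> weakly_invertible M (eq_stage M (max r s)) k"
    unfolding weakly_invertible_def by blast
  then have "f \<in> eq_stage M (Suc (max r s)) k"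
    by (auto simp: composites_def intro: in_composites.base)
  then show ?thesis unfolding internal_equivalences_def by blast
qed

lemma weakly_invertible_mono:
  "(\<And>k. S k \<subseteq> T k) \<Longrightarrow> weakly_invertible M S k \<subseteq> weakly_invertible M T k"
  unfolding weakly_invertible_def by blast

text \<open>
  The stages disappear from the induction rule since weak invertibility is monotone: an inverse
  witnessed at some stage is witnessed by internal equivalences.
\<close>

lemma internal_equivalences_induct [consumes 1, case_names elementary cmp weakly_invertible]:
  assumes "f \<in> internal_equivalences M k"
    and el: "\<And>k f. f \<in> elementary_equivalences M k \<Longrightarrow> P k f"
    and cmp: "\<And>i j a b. P j a \<Longrightarrow> P j b \<Longrightarrow> composable M i j a b \<Longrightarrow> P j (cmp M i j a b)"
    and inv: "\<And>k f. f \<in> weakly_invertible M (internal_equivalences M) k \<Longrightarrow> P k f"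
  shows "P k f"
proof -
  have composites: "P k f" if "in_composites M S k f" "\<And>k f. f \<in> S k \<Longrightarrow> P k f" for S k f
    using that by (induction rule: in_composites.induct) (auto intro: cmp)
  have stage: "P k f" if "f \<in> eq_stage M r k" for r k f
    using that
  proof (induction r arbitrary: k f)
    case 0
    then show ?case using composites el by (auto simp: composites_def)
  next
    case (Suc r)
    have "f \<in> weakly_invertible M (internal_equivalences M) k"
      if "f \<in> weakly_invertible M (eq_stage M r) k" for k f
      using weakly_invertible_mono[of "eq_stage M r" "internal_equivalences M"] that
      by (auto simp: internal_equivalences_def)
    with Suc.IH inv have "P k f" if "f \<in> eq_stage M r k \<union> weakly_invertible M (eq_stage M r) k" for k f
      using that by blast
    then show ?case
      using composites[of "\<lambda>k. eq_stage M r k \<union> weakly_invertible M (eq_stage M r) k"] Suc.prems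
      by (simp add: composites_def)
  qed
  then show ?thesis using assms(1) by (auto simp: internal_equivalences_def)
qed

definition equivalent :: "'a omagma \<Rightarrow> nat \<Rightarrow> 'a \<Rightarrow> 'a \<Rightarrow> bool" where
  "equivalent M k a b \<longleftrightarrow>
     (\<exists>h\<in>internal_equivalences M (Suc k). dom1 M k h = a \<and> cod1 M k h = b)"

text \<open>
  The second identity is written on the domain of \<open>g\<close>, which is the codomain of \<open>f\<close>, to make the
  symmetry between \<open>f\<close> and \<open>g\<close> visible.
\<close>

definition quasi_inverse :: "'a omagma \<Rightarrow> nat \<Rightarrow> 'a \<Rightarrow> 'a \<Rightarrow> bool" where
  "quasi_inverse M m f g \<longleftrightarrow> f \<in> cells M (Suc m) \<and> g \<in> cells M (Suc m) \<and>
     dom1 M m g = cod1 M m f \<and> cod1 M m g = dom1 M m f \<and>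
     equivalent M (Suc m) (cmp M m (Suc m) f g) (id1 M m (dom1 M m f)) \<and>
     equivalent M (Suc m) (cmp M m (Suc m) g f) (id1 M m (dom1 M m g))"

lemma quasi_inverse_sym: "quasi_inverse M m f g \<Longrightarrow> quasi_inverse M m g f"
  by (auto simp: quasi_inverse_def)

lemma weakly_invertible_iff:
  "f \<in> weakly_invertible M (internal_equivalences M) k \<longleftrightarrow>
     (\<exists>m g. k = Suc m \<and> quasi_inverse M m f g)"
  unfolding weakly_invertible_def quasi_inverse_def equivalent_def by fastforce

context omega_magma
begin

lemma internal_equivalence_cell: "f \<in> internal_equivalences M k \<Longrightarrow> f \<in> cells M k"
proof (induction rule: internal_equivalences_induct)
  case (elementary k f)
  then show ?case by (simp add: elementary_equivalences_def)
next
  case (cmp i j a b)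
  then show ?case by (simp add: cmp_cell)
next
  case (weakly_invertible k f)
  then show ?case by (simp add: weakly_invertible_def)
qed

lemma identity_internal_equivalence:
  "a \<in> cells M k \<Longrightarrow> id1 M k a \<in> internal_equivalences M (Suc k)"
  by (rule elementary_equivalences_internal)
    (simp add: elementary_equivalences_def identity_cell_def id1_cell)

lemma equivalent_refl: "a \<in> cells M k \<Longrightarrow> equivalent M k a a"
  unfolding equivalent_def
  by (rule bexI[of _ "id1 M k a"]) (simp_all add: dom1_id1 cod1_id1 identity_internal_equivalence)

lemma equivalent_trans [trans]:
  assumes "equivalent M k a b" "equivalent M k b c" shows "equivalent M k a c"
proof -
  obtain h h' where h: "h \<in> internal_equivalences M (Suc k)" "dom1 M k h = a" "cod1 M k h = b"
      "h' \<in> internal_equivalences M (Suc k)" "dom1 M k h' = b" "cod1 M k h' = c"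
    using assms by (auto simp: equivalent_def)
  then have "composable M k (Suc k) h h'" by (simp add: internal_equivalence_cell)
  with h show ?thesis
    unfolding equivalent_def
    by (intro bexI[of _ "cmp M k (Suc k) h h'"])
      (auto simp: internal_equivalences_cmp dom1_cmp_top cod1_cmp_top)
qed

lemma equivalent_cmp:
  assumes "equivalent M k a a'" "equivalent M k b b'" and c: "composable M i k a b"
  shows "equivalent M k (cmp M i k a b) (cmp M i k a' b')"
proof -
  obtain h h' where h: "h \<in> internal_equivalences M (Suc k)" "dom1 M k h = a" "cod1 M k h = a'"
      "h' \<in> internal_equivalences M (Suc k)" "dom1 M k h' = b" "cod1 M k h' = b'"
    using assms by (auto simp: equivalent_def)
  have "i < k" using c by (simp add: composable_def)
  have hc: "composable M i (Suc k) h h'"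
    using h c codn_dom1[OF \<open>i < k\<close>, of h] domn_cod1[OF \<open>i < k\<close>, of h']
    by (auto simp: composable_def internal_equivalence_cell)
  with h \<open>i < k\<close> show ?thesis
    unfolding equivalent_def
    by (intro bexI[of _ "cmp M i (Suc k) h h'"])
      (auto simp: internal_equivalences_cmp dom1_cmp cod1_cmp)
qed

text \<open>
  In \<open>Cl(2)\<close> the composite of the generators \<open>1 \<rightarrow> 2 \<rightarrow> 1\<close> is parallel to the identity of \<open>1\<close>, hence
  bridged to it, and \<open>H\<close> turns this bridge into an elementary equivalence.
\<close>

lemma elementary_equivalence_quasi_inverse:
  assumes H: "magma_morphism Cl2 (shift M m) H"
  shows "quasi_inverse M m (H 1 (clc 1 2)) (H 1 (clc 2 1))"
proof -
  have *: "equivalent M (Suc m) (cmp M m (Suc m) (H 1 (clc p q)) (H 1 (clc q p)))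
      (id1 M m (dom1 M m (H 1 (clc p q))))"
      "H 1 (clc p q) \<in> cells M (Suc m)" "dom1 M m (H 1 (clc p q)) = H 0 (Pt p)"
      "cod1 M m (H 1 (clc p q)) = H 0 (Pt q)"
    if pq: "p \<in> {1, 2}" "q \<in> {1, 2}" "p \<noteq> q" for p q
  proof -
    let ?f = "Brg (Pt p) (Pt q)" and ?g = "Brg (Pt q) (Pt p)"
    let ?c = "Cmp 0 1 ?f ?g"
    have cells: "clcell 0 (Pt p)" "clcell 0 (Pt q)" "clcell 1 ?f" "clcell 1 ?g"
      using pq by (auto intro!: clcell.intros)
    then have comp: "composable Cl2 0 1 ?f ?g"
      by simp
    have bridge: "(?c, Idc (Pt p), Brg ?c (Idc (Pt p))) \<in> Cl2_bridges 1"
      using cells comp by (auto simp: Cl2_bridges_def Cl2_parallel clcell_Cmp_iff intro: clcell.Idc)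
    then have cell: "clcell (Suc 1) (Brg ?c (Idc (Pt p)))" by (rule Cl2_bridge_cell)
    have h: "H (Suc 1) (Brg ?c (Idc (Pt p))) \<in> internal_equivalences M (Suc (Suc m))"
      using Penon_bridge_elementary[OF Cl2_Penon_morphism omega_magma_axioms H bridge]
      by (simp add: elementary_equivalences_internal)
    note mor = magma_morphismD[OF H] and graph = graph_morphismD[OF magma_morphismD(1)[OF H]]
    have "dom1 M (Suc m) (H (Suc 1) (Brg ?c (Idc (Pt p)))) = H 1 ?c"
      "cod1 M (Suc m) (H (Suc 1) (Brg ?c (Idc (Pt p)))) = H 1 (Idc (Pt p))"
      using graph(3,4)[of "Brg ?c (Idc (Pt p))" 1] cell by simp_all
    moreover have "H 1 ?c = cmp M m (Suc m) (H 1 ?f) (H 1 ?g)"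
      using mor(2)[OF comp] by simp
    moreover have "H 1 (Idc (Pt p)) = id1 M m (H 0 (Pt p))"
      using graph(5)[of "Pt p" 0] cells by simp
    moreover have f: "H 1 ?f \<in> cells M (Suc m)" "dom1 M m (H 1 ?f) = H 0 (Pt p)"
        "cod1 M m (H 1 ?f) = H 0 (Pt q)"
      using graph(2)[of ?f 1] graph(3,4)[of ?f 0] cells by simp_all
    moreover have "clc p q = ?f" "clc q p = ?g" using pq by (simp_all add: clc_neq)
    ultimately
    show "equivalent M (Suc m) (cmp M m (Suc m) (H 1 (clc p q)) (H 1 (clc q p)))
        (id1 M m (dom1 M m (H 1 (clc p q))))"
      "H 1 (clc p q) \<in> cells M (Suc m)" "dom1 M m (H 1 (clc p q)) = H 0 (Pt p)"
      "cod1 M m (H 1 (clc p q)) = H 0 (Pt q)"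
      using h unfolding equivalent_def by auto
  qed
  show ?thesis
    using *[of 1 2] *[of 2 1] by (simp add: quasi_inverse_def)
qed

end

section \<open>Coherence\<close>

text \<open>
  Two cells of the underlying magma are coherent if they are values of formal composites \<open>u\<close>, \<open>v\<close> in the
  middle magma that the strict omega category identifies. The four laws below lift their cells by
  \<open>rho\<close>, which is a section of \<open>lam\<close> but need not preserve composites: the formal composite is formed
  after lifting.
\<close>

definition coherent :: "('a, 'b, 'c) weak_ocat \<Rightarrow> nat \<Rightarrow> 'a \<Rightarrow> 'a \<Rightarrow> bool" where
  "coherent X k a b \<longleftrightarrow> (\<exists>u v. parallel (mag2 X) k u v \<and> kappa X k u = kappa X k v \<and>
     lam X k u = a \<and> lam X k v = b)"

lemma coherent_sym: "coherent X k a b \<Longrightarrow> coherent X k b a"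
  by (force simp: coherent_def parallel_def)

context weak_omega_category
begin

sublocale M1: omega_magma "mag1 X" by (fact mag1)
sublocale M2: omega_magma "mag2 X" by (fact mag2)
sublocale M3: strict_omega_category "mag3 X" by (fact mag3)

lemma kappa_morphism: "magma_morphism (mag2 X) (mag3 X) (kappa X)"
  using kappa by (simp add: categorical_Penon_morphism_def bridge_morphism_def)

lemmas rho_simps = graph_morphismD[OF rho]
lemmas lam_simps = graph_morphismD[OF magma_morphismD(1)[OF lam]] magma_morphismD(2)[OF lam]
lemmas kappa_simps =
  graph_morphismD[OF magma_morphismD(1)[OF kappa_morphism]] magma_morphismD(2)[OF kappa_morphism]

lemma rho_composable:
  "composable (mag1 X) i j a b \<Longrightarrow> composable (mag2 X) i j (rho X j a) (rho X j b)"
  by (rule globular_composable[OF rho_simps(1) M1.globular_set_axioms])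

lemma kappa_composable:
  "composable (mag2 X) i j a b \<Longrightarrow> composable (mag3 X) i j (kappa X j a) (kappa X j b)"
  by (rule globular_composable[OF kappa_simps(1) M2.globular_set_axioms])

text \<open>
  The Penon property provides a bridge from \<open>u\<close> to \<open>v\<close>, and \<open>lam\<close> maps it to an elementary equivalence.
\<close>

lemma coherent_equivalent:
  assumes "coherent X k a b" shows "equivalent (mag1 X) k a b"
proof -
  obtain u v where uv: "parallel (mag2 X) k u v" "kappa X k u = kappa X k v"
      "lam X k u = a" "lam X k v = b"
    using assms by (auto simp: coherent_def)
  then obtain c where c: "(u, v, c) \<in> bridges X k"
    using kappa unfolding categorical_Penon_morphism_def by blast
  have "magma_morphism (mag2 X) (shift (mag1 X) 0) (lam X)" using lam by simp
  from Penon_bridge_elementary[OF kappa mag1 this c]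
  have "lam X (Suc k) c \<in> internal_equivalences (mag1 X) (Suc k)"
    by (simp add: elementary_equivalences_internal)
  moreover have "c \<in> cells (mag2 X) (Suc k)" "dom1 (mag2 X) k c = u" "cod1 (mag2 X) k c = v"
    using bridges c unfolding bridge_relation_def by blast+
  ultimately show ?thesis
    using uv lam_simps(3,4)[of c k] unfolding equivalent_def by auto
qed

lemma coherent_assoc:
  assumes ab: "composable (mag1 X) m (Suc m) a b" and bc: "composable (mag1 X) m (Suc m) b c"
  shows "coherent X (Suc m) (cmp (mag1 X) m (Suc m) (cmp (mag1 X) m (Suc m) a b) c)
    (cmp (mag1 X) m (Suc m) a (cmp (mag1 X) m (Suc m) b c))"
proof -
  let ?r = "rho X (Suc m)" and ?o = "cmp (mag2 X) m (Suc m)"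
  note AB = rho_composable[OF ab] and BC = rho_composable[OF bc]
  have AB_C: "composable (mag2 X) m (Suc m) (?o (?r a) (?r b)) (?r c)"
    and A_BC: "composable (mag2 X) m (Suc m) (?r a) (?o (?r b) (?r c))"
    using AB BC M2.cmp_cell[OF AB] M2.cmp_cell[OF BC] by (simp_all add: M2.dom1_cmp_top M2.cod1_cmp_top)
  let ?u = "?o (?o (?r a) (?r b)) (?r c)" and ?v = "?o (?r a) (?o (?r b) (?r c))"
  note C = AB BC AB_C A_BC
  have "parallel (mag2 X) (Suc m) ?u ?v"
    using C M2.cmp_cell[OF A_BC] M2.cmp_cell[OF AB_C]
    by (simp add: parallel_def M2.dom1_cmp_top M2.cod1_cmp_top)
  moreover have "kappa X (Suc m) ?u = kappa X (Suc m) ?v"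
    using M3.cmp_assoc[of m "Suc m" "kappa X (Suc m) (?r a)" "kappa X (Suc m) (?r b)" "kappa X (Suc m) (?r c)"]
      C[THEN kappa_composable] C[THEN kappa_simps(6)] by (simp del: composable_top)
  moreover have "lam X (Suc m) ?u = cmp (mag1 X) m (Suc m) (cmp (mag1 X) m (Suc m) a b) c"
    "lam X (Suc m) ?v = cmp (mag1 X) m (Suc m) a (cmp (mag1 X) m (Suc m) b c)"
    using C[THEN lam_simps(6)] ab bc by (simp_all add: lam_rho)
  ultimately show ?thesis unfolding coherent_def by blast
qed

lemma coherent_unit_left:
  assumes a: "a \<in> cells (mag1 X) (Suc m)"
  shows "coherent X (Suc m) (cmp (mag1 X) m (Suc m) (id1 (mag1 X) m (dom1 (mag1 X) m a)) a) a"
proof -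
  let ?a = "rho X (Suc m) a"
  let ?i = "id1 (mag2 X) m (dom1 (mag2 X) m ?a)"
  let ?u = "cmp (mag2 X) m (Suc m) ?i ?a"
  have A: "?a \<in> cells (mag2 X) (Suc m)" using a by (rule rho_simps)
  then have C: "composable (mag2 X) m (Suc m) ?i ?a"
    by (simp add: M2.dom1_cell M2.id1_cell M2.cod1_id1)
  have "parallel (mag2 X) (Suc m) ?u ?a"
    using A C M2.cmp_cell[OF C] M2.dom1_cmp_top[OF C] M2.cod1_cmp_top[OF C]
    by (simp add: parallel_def M2.dom1_cell M2.dom1_id1)
  moreover have "kappa X (Suc m) ?u = kappa X (Suc m) ?a"
    using M3.cmp_unit_left[of m "Suc m" "kappa X (Suc m) ?a"] A kappa_simps(6)[OF C]
    by (simp add: kappa_simps M2.dom1_cell)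
  moreover have "lam X (Suc m) ?u = cmp (mag1 X) m (Suc m) (id1 (mag1 X) m (dom1 (mag1 X) m a)) a"
    using lam_simps(6)[OF C] A a lam_simps(3)[OF A] by (simp add: lam_simps(5) M2.dom1_cell lam_rho)
  ultimately show ?thesis using lam_rho[OF a] unfolding coherent_def by blast
qed

lemma coherent_interchange:
  assumes im: "i < m"
    and ab: "composable (mag1 X) m (Suc m) a b" and cd: "composable (mag1 X) m (Suc m) c d"
    and ac: "composable (mag1 X) i (Suc m) a c" and bd: "composable (mag1 X) i (Suc m) b d"
  shows "coherent X (Suc m)
    (cmp (mag1 X) m (Suc m) (cmp (mag1 X) i (Suc m) a c) (cmp (mag1 X) i (Suc m) b d))
    (cmp (mag1 X) i (Suc m) (cmp (mag1 X) m (Suc m) a b) (cmp (mag1 X) m (Suc m) c d))"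
proof -
  let ?r = "rho X (Suc m)" and ?o = "cmp (mag2 X) m (Suc m)" and ?p = "cmp (mag2 X) i (Suc m)"
  note AB = rho_composable[OF ab] and CD = rho_composable[OF cd]
    and AC = rho_composable[OF ac] and BD = rho_composable[OF bd]
  have u: "composable (mag2 X) m (Suc m) (?p (?r a) (?r c)) (?p (?r b) (?r d))"
    using AB CD M2.cmp_cell[OF AC] M2.cmp_cell[OF BD] M2.dom1_cmp[OF im BD] M2.cod1_cmp[OF im AC]
    by simp
  have v: "composable (mag2 X) i (Suc m) (?o (?r a) (?r b)) (?o (?r c) (?r d))"
    using BD AC M2.cmp_cell[OF AB] M2.cmp_cell[OF CD] im AB CD
      M2.dom1_cmp_top[OF AB] M2.dom1_cmp_top[OF CD] M2.cod1_cmp_top[OF AB] M2.cod1_cmp_top[OF CD]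
      M2.codn_dom1[OF im, of "?r a"] M2.codn_dom1[OF im, of "?r b"]
      M2.domn_cod1[OF im, of "?r c"] M2.domn_cod1[OF im, of "?r d"]
    by (simp add: composable_def)
  let ?u = "?o (?p (?r a) (?r c)) (?p (?r b) (?r d))" and ?v = "?p (?o (?r a) (?r b)) (?o (?r c) (?r d))"
  note C = AB CD AC BD u v
  have "parallel (mag2 X) (Suc m) ?u ?v"
    using M2.cmp_cell[OF u] M2.cmp_cell[OF v] M2.dom1_cmp_top[OF AB] M2.dom1_cmp_top[OF CD]
      M2.cod1_cmp_top[OF AB] M2.cod1_cmp_top[OF CD]
      M2.dom1_cmp[OF im AC] M2.cod1_cmp[OF im BD] M2.dom1_cmp_top[OF u] M2.cod1_cmp_top[OF u]
      M2.dom1_cmp[OF im v] M2.cod1_cmp[OF im v]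
    by (simp add: parallel_def)
  moreover have "kappa X (Suc m) ?u = kappa X (Suc m) ?v"
    using M3.interchange[OF im, of "Suc m" "kappa X (Suc m) (?r a)" "kappa X (Suc m) (?r b)"
        "kappa X (Suc m) (?r c)" "kappa X (Suc m) (?r d)"]
      C[THEN kappa_composable] C[THEN kappa_simps(6)] by (simp del: composable_top)
  moreover have "lam X (Suc m) ?u =
      cmp (mag1 X) m (Suc m) (cmp (mag1 X) i (Suc m) a c) (cmp (mag1 X) i (Suc m) b d)"
    "lam X (Suc m) ?v =
      cmp (mag1 X) i (Suc m) (cmp (mag1 X) m (Suc m) a b) (cmp (mag1 X) m (Suc m) c d)"
    using C[THEN lam_simps(6)] ab cd by (simp_all add: lam_rho)
  ultimately show ?thesis unfolding coherent_def by blast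
qed

lemma coherent_cmp_id:
  assumes ab: "composable (mag1 X) i m a b"
  shows "coherent X (Suc m) (cmp (mag1 X) i (Suc m) (id1 (mag1 X) m a) (id1 (mag1 X) m b))
    (id1 (mag1 X) m (cmp (mag1 X) i m a b))"
proof -
  let ?a = "rho X m a" and ?b = "rho X m b"
  note AB = rho_composable[OF ab]
  note C = M2.composable_id1[OF AB]
  have im: "i < m" and cells: "?a \<in> cells (mag2 X) m" "?b \<in> cells (mag2 X) m"
      "a \<in> cells (mag1 X) m" "b \<in> cells (mag1 X) m"
    using AB ab by (simp_all add: composable_def)
  let ?u = "cmp (mag2 X) i (Suc m) (id1 (mag2 X) m ?a) (id1 (mag2 X) m ?b)"
  let ?v = "id1 (mag2 X) m (cmp (mag2 X) i m ?a ?b)"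
  have "parallel (mag2 X) (Suc m) ?u ?v"
    using M2.cmp_cell[OF AB] M2.cmp_cell[OF C] M2.dom1_cmp[OF im C] M2.cod1_cmp[OF im C] cells
    by (simp add: parallel_def M2.dom1_id1 M2.cod1_id1 M2.id1_cell)
  moreover have "kappa X (Suc m) ?u = kappa X (Suc m) ?v"
    using M3.cmp_id1[OF kappa_composable[OF AB]] kappa_simps(6)[OF AB] kappa_simps(6)[OF C] cells
      M2.cmp_cell[OF AB] by (simp add: kappa_simps(5))
  moreover have "lam X (Suc m) ?u = cmp (mag1 X) i (Suc m) (id1 (mag1 X) m a) (id1 (mag1 X) m b)"
    "lam X (Suc m) ?v = id1 (mag1 X) m (cmp (mag1 X) i m a b)"
    using lam_simps(6)[OF AB] lam_simps(6)[OF C] cells M2.cmp_cell[OF AB]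
    by (simp_all add: lam_simps(5) lam_rho)
  ultimately show ?thesis unfolding coherent_def by blast
qed

section \<open>Internal equivalences are weakly invertible\<close>

lemma identity_quasi_inverse:
  assumes "x \<in> cells (mag1 X) m"
  shows "quasi_inverse (mag1 X) m (id1 (mag1 X) m x) (id1 (mag1 X) m x)"
  using coherent_equivalent[OF coherent_unit_left[OF M1.id1_cell[OF assms]]] assms
  by (simp add: quasi_inverse_def M1.id1_cell M1.dom1_id1 M1.cod1_id1)

text \<open>
  The calculation \<open>(f f') (g' g) \<simeq> f (f' (g' g)) \<simeq> f ((f' g') g) \<simeq> f (1 g) \<simeq> f g \<simeq> 1\<close>. It gives one half
  of the next lemma; the other half is the same calculation with the roles of the cells and their
  inverses exchanged.
\<close>

lemma cancel_inner_inverse: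
  assumes f: "composable (mag1 X) m (Suc m) f f'"
    and fg: "quasi_inverse (mag1 X) m f g" and fg': "quasi_inverse (mag1 X) m f' g'"
  shows "equivalent (mag1 X) (Suc m)
    (cmp (mag1 X) m (Suc m) (cmp (mag1 X) m (Suc m) f f') (cmp (mag1 X) m (Suc m) g' g))
    (id1 (mag1 X) m (dom1 (mag1 X) m f))"
proof -
  let ?M = "mag1 X"
  let ?o = "cmp (mag1 X) m (Suc m)"
  let ?i = "id1 ?M m (dom1 ?M m f')"
  note M1.cmp_cell[of m "Suc m", simp] M1.dom1_cmp_top [simp] M1.cod1_cmp_top [simp]
  have cells: "f \<in> cells ?M (Suc m)" "f' \<in> cells ?M (Suc m)" "g \<in> cells ?M (Suc m)"
     "g' \<in> cells ?M (Suc m)" "dom1 ?M m g = cod1 ?M m f" "cod1 ?M m g = dom1 ?M m f"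
     "dom1 ?M m g' = cod1 ?M m f'" "cod1 ?M m g' = dom1 ?M m f'" "cod1 ?M m f = dom1 ?M m f'"
    using assms by (auto simp: quasi_inverse_def)
  have "equivalent ?M (Suc m) (?o (?o f f') (?o g' g)) (?o f (?o f' (?o g' g)))"
    using cells by (intro coherent_equivalent coherent_assoc) simp_all
  also have "equivalent ?M (Suc m) \<dots> (?o f (?o (?o f' g') g))"
    using cells
    by (intro M1.equivalent_cmp M1.equivalent_refl coherent_equivalent coherent_sym[OF coherent_assoc])
      simp_all
  also have "equivalent ?M (Suc m) \<dots> (?o f (?o ?i g))"
    using cells fg' by (intro M1.equivalent_cmp M1.equivalent_refl) (simp_all add: quasi_inverse_def)
  also have "equivalent ?M (Suc m) \<dots> (?o f g)"
  proof (intro M1.equivalent_cmp M1.equivalent_refl)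
    show "equivalent ?M (Suc m) (?o ?i g) g"
      using coherent_equivalent[OF coherent_unit_left[of g m]] cells by simp
  qed (use cells in \<open>simp_all add: M1.dom1_id1 M1.cod1_id1 M1.id1_cell M1.dom1_cell\<close>)
  also have "equivalent ?M (Suc m) \<dots> (id1 ?M m (dom1 ?M m f))"
    using fg by (simp add: quasi_inverse_def)
  finally show ?thesis .
qed

lemma quasi_inverse_cmp_top:
  assumes f: "composable (mag1 X) m (Suc m) f f'"
    and fg: "quasi_inverse (mag1 X) m f g" and fg': "quasi_inverse (mag1 X) m f' g'"
  shows "quasi_inverse (mag1 X) m (cmp (mag1 X) m (Suc m) f f') (cmp (mag1 X) m (Suc m) g' g)"
proof -
  have g: "composable (mag1 X) m (Suc m) g' g"
    using assms by (auto simp: quasi_inverse_def)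
  show ?thesis
    using cancel_inner_inverse[OF assms]
      cancel_inner_inverse[OF g fg'[THEN quasi_inverse_sym] fg[THEN quasi_inverse_sym]]
      M1.cmp_cell[OF f] M1.cmp_cell[OF g] f g fg fg'
    by (simp add: quasi_inverse_def M1.dom1_cmp_top M1.cod1_cmp_top)
qed

text \<open>
  Along a lower dimension \<open>i\<close> the inverse is composed in the same order:
  \<open>(f \<circ>\<^sub>i f') (g \<circ>\<^sub>i g') \<simeq> (f g) \<circ>\<^sub>i (f' g') \<simeq> 1 \<circ>\<^sub>i 1 \<simeq> 1\<close>.
\<close>

lemma cancel_parallel_inverse:
  assumes im: "i < m" and f: "composable (mag1 X) i (Suc m) f f'" and g: "composable (mag1 X) i (Suc m) g g'"
    and fg: "quasi_inverse (mag1 X) m f g" and fg': "quasi_inverse (mag1 X) m f' g'"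
  shows "equivalent (mag1 X) (Suc m)
    (cmp (mag1 X) m (Suc m) (cmp (mag1 X) i (Suc m) f f') (cmp (mag1 X) i (Suc m) g g'))
    (id1 (mag1 X) m (dom1 (mag1 X) m (cmp (mag1 X) i (Suc m) f f')))"
proof -
  let ?M = "mag1 X"
  let ?o = "cmp ?M m (Suc m)" and ?p = "cmp ?M i (Suc m)"
  have c: "composable ?M m (Suc m) f g" "composable ?M m (Suc m) f' g'"
    using fg fg' by (auto simp: quasi_inverse_def)
  have "equivalent ?M (Suc m) (?o (?p f f') (?p g g')) (?p (?o f g) (?o f' g'))"
    by (rule coherent_equivalent[OF coherent_interchange[OF im c f g]])
  also have "equivalent ?M (Suc m) \<dots> (?p (id1 ?M m (dom1 ?M m f)) (id1 ?M m (dom1 ?M m f')))"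
  proof (rule M1.equivalent_cmp)
    show "composable ?M i (Suc m) (?o f g) (?o f' g')"
      using f g im c M1.cmp_cell[OF c(1)] M1.cmp_cell[OF c(2)] M1.dom1_cmp_top[OF c(2)]
        M1.cod1_cmp_top[OF c(1)] M1.domn_cod1[OF im, of f'] M1.codn_dom1[OF im, of g]
        M1.codn_dom1[OF im, of f]
      by (simp add: composable_def)
  qed (use fg fg' in \<open>simp_all add: quasi_inverse_def\<close>)
  also have "equivalent ?M (Suc m) \<dots> (id1 ?M m (cmp ?M i m (dom1 ?M m f) (dom1 ?M m f')))"
    by (rule coherent_equivalent[OF coherent_cmp_id[OF M1.composable_dom1[OF im f]]])
  finally show ?thesis using M1.dom1_cmp[OF im f] by simp
qed

lemma quasi_inverse_cmp_below:
  assumes im: "i < m" and f: "composable (mag1 X) i (Suc m) f f'"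
    and fg: "quasi_inverse (mag1 X) m f g" and fg': "quasi_inverse (mag1 X) m f' g'"
  shows "quasi_inverse (mag1 X) m (cmp (mag1 X) i (Suc m) f f') (cmp (mag1 X) i (Suc m) g g')"
proof -
  have g: "composable (mag1 X) i (Suc m) g g'"
    using im f fg fg' M1.codn_dom1[OF im, of f] M1.domn_cod1[OF im, of f']
    by (simp add: composable_def quasi_inverse_def)
  show ?thesis
    using cancel_parallel_inverse[OF im f g fg fg']
      cancel_parallel_inverse[OF im g f fg[THEN quasi_inverse_sym] fg'[THEN quasi_inverse_sym]]
      M1.cmp_cell[OF f] M1.cmp_cell[OF g] M1.dom1_cmp[OF im] M1.cod1_cmp[OF im] f g fg fg'
    by (simp add: quasi_inverse_def)
qed

text \<open>
  Closing the generators under composites adds nothing beyond weakly invertible cells, so having a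
  quasi-inverse characterises internal equivalences. It is this direction that needs the coherence of
  a weak omega category; in a bare omega magma a composite of invertible cells may lack an inverse.
\<close>

lemma internal_equivalence_quasi_inverse:
  assumes "f \<in> internal_equivalences (mag1 X) k"
  shows "\<exists>m g. k = Suc m \<and> quasi_inverse (mag1 X) m f g"
  using assms
proof (induction rule: internal_equivalences_induct)
  case (elementary k f)
  then obtain m where m: "k = Suc m"
    by (cases k) (auto simp: elementary_equivalences_def identity_cell_def)
  from elementary[unfolded m] show ?case
  proof (cases rule: elementary_equivalence_cases)
    case 1
    then show ?thesis using identity_quasi_inverse m by (auto simp: identity_cell_def)
  next
    case (2 H)
    then show ?thesis using M1.elementary_equivalence_quasi_inverse[OF 2(1)] m by auto
  qed
next
  case (cmp i j f f')
  then obtain m g g' where *: "j = Suc m" "quasi_inverse (mag1 X) m f g" "quasi_inverse (mag1 X) m f' g'"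
    by blast
  then have "i = m \<or> i < m" using cmp.hyps by (auto simp: composable_def)
  then show ?case
  proof
    assume "i = m"
    then show ?thesis using quasi_inverse_cmp_top[of m f f' g g'] cmp.hyps * by blast
  next
    assume "i < m"
    then show ?thesis using quasi_inverse_cmp_below[of i m f f' g g'] cmp.hyps * by blast
  qed
next
  case (weakly_invertible k f)
  then show ?case by (simp add: weakly_invertible_iff)
qed

end

section \<open>Pseudo-functors between skeletal weak categories\<close>

context omega_pseudofunctor
begin

lemmas fun1_simps = fun1[unfolded globular_morphism_def, THEN conjunct1, rule_format]
  fun1[unfolded globular_morphism_def, THEN conjunct2, THEN conjunct1, rule_format]
  fun1[unfolded globular_morphism_def, THEN conjunct2, THEN conjunct2, rule_format]

lemmas fun2_simps = fun2[unfolded globular_morphism_def, THEN conjunct1, rule_format]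
  fun2[unfolded globular_morphism_def, THEN conjunct2, THEN conjunct1, rule_format]
  fun2[unfolded globular_morphism_def, THEN conjunct2, THEN conjunct2, rule_format]

lemma fun1_rho: "a \<in> cells (mag1 X) k \<Longrightarrow> lam Y k (fun2 F k (rho X k a)) = fun1 F k a"
  using fun1_lam[OF X.rho_simps(2)] X.lam_rho by simp

text \<open>
  Both cells come from the middle magma of \<open>Y\<close>, where \<open>fun2\<close> of a lifted composite and the composite
  of the images are parallel and agree after \<open>kappa\<close>: this is the compatibility of a pseudo-functor
  with composition.
\<close>

lemma coherent_fun1_cmp:
  assumes c: "composable (mag1 X) m (Suc m) f g"
  shows "coherent Y (Suc m) (cmp (mag1 Y) m (Suc m) (fun1 F (Suc m) f) (fun1 F (Suc m) g))
    (fun1 F (Suc m) (cmp (mag1 X) m (Suc m) f g))"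
proof -
  let ?f = "rho X (Suc m) f" and ?g = "rho X (Suc m) g"
  let ?F = "fun2 F (Suc m)"
  let ?u = "cmp (mag2 Y) m (Suc m) (?F ?f) (?F ?g)" and ?v = "?F (cmp (mag2 X) m (Suc m) ?f ?g)"
  note r = X.rho_composable[OF c]
  note Fr = globular_composable[OF fun2 X.M2.globular_set_axioms r]
  have "parallel (mag2 Y) (Suc m) ?u ?v"
    using X.M2.cmp_cell[OF r] Y.M2.cmp_cell[OF Fr] r Fr
    by (simp add: parallel_def fun2_simps(1) fun2_simps(2,3)[symmetric]
        X.M2.dom1_cmp_top X.M2.cod1_cmp_top Y.M2.dom1_cmp_top Y.M2.cod1_cmp_top)
  moreover have "kappa Y (Suc m) ?u = kappa Y (Suc m) ?v" by (rule kappa_cmp[OF r])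
  moreover have "lam Y (Suc m) ?u = cmp (mag1 Y) m (Suc m) (fun1 F (Suc m) f) (fun1 F (Suc m) g)"
    using Y.lam_simps(6)[OF Fr] c by (simp add: fun1_rho)
  moreover have "lam Y (Suc m) ?v = fun1 F (Suc m) (cmp (mag1 X) m (Suc m) f g)"
    using fun1_lam[OF X.M2.cmp_cell[OF r]] X.lam_simps(6)[OF r] c by (simp add: X.lam_rho)
  ultimately show ?thesis unfolding coherent_def by blast
qed

text \<open>
  Neither \<open>fun1\<close> nor \<open>fun2\<close> need respect identities, but \<open>fun3\<close> does, and \<open>rho\<close> lifts identities
  to identities.
\<close>

lemma coherent_fun1_id:
  assumes x: "x \<in> cells (mag1 X) m"
  shows "coherent Y (Suc m) (fun1 F (Suc m) (id1 (mag1 X) m x)) (id1 (mag1 Y) m (fun1 F m x))"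
proof -
  let ?x = "rho X m x"
  let ?u = "fun2 F (Suc m) (id1 (mag2 X) m ?x)" and ?v = "id1 (mag2 Y) m (fun2 F m ?x)"
  have r: "?x \<in> cells (mag2 X) m" "fun2 F m ?x \<in> cells (mag2 Y) m"
    using x by (simp_all add: X.rho_simps(2) fun2_simps(1))
  have "parallel (mag2 Y) (Suc m) ?u ?v"
    using r by (simp add: parallel_def fun2_simps(1) fun2_simps(2,3)[symmetric]
        X.M2.id1_cell X.M2.dom1_id1 X.M2.cod1_id1 Y.M2.id1_cell Y.M2.dom1_id1 Y.M2.cod1_id1)
  moreover have "kappa Y (Suc m) ?u = kappa Y (Suc m) ?v"
    using fun3_kappa[OF r(1)] fun3_kappa[OF X.M2.id1_cell[OF r(1)]] r
      graph_morphismD(5)[OF fun3 X.kappa_simps(2)[OF r(1)]]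
    by (simp add: X.kappa_simps(5) Y.kappa_simps(5))
  moreover have "lam Y (Suc m) ?u = fun1 F (Suc m) (id1 (mag1 X) m x)"
    using fun1_lam[OF X.M2.id1_cell[OF r(1)]] r x by (simp add: X.lam_simps(5) X.lam_rho)
  moreover have "lam Y (Suc m) ?v = id1 (mag1 Y) m (fun1 F m x)"
    using r x by (simp add: Y.lam_simps(5) fun1_rho)
  ultimately show ?thesis unfolding coherent_def by blast
qed

text \<open>
  The calculation \<open>(F f) (F g) \<simeq> F (f g) \<simeq> F 1 \<simeq> 1\<close>, whose middle step is the image of the given
  equivalence.
\<close>

lemma fun1_equivalent_id:
  assumes IH: "fun1 F (Suc (Suc m)) ` internal_equivalences (mag1 X) (Suc (Suc m))
      \<subseteq> internal_equivalences (mag1 Y) (Suc (Suc m))"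
    and c: "composable (mag1 X) m (Suc m) f g"
    and x: "x \<in> cells (mag1 X) m"
    and fg: "equivalent (mag1 X) (Suc m) (cmp (mag1 X) m (Suc m) f g) (id1 (mag1 X) m x)"
  shows "equivalent (mag1 Y) (Suc m)
    (cmp (mag1 Y) m (Suc m) (fun1 F (Suc m) f) (fun1 F (Suc m) g)) (id1 (mag1 Y) m (fun1 F m x))"
proof -
  obtain h where h: "h \<in> internal_equivalences (mag1 X) (Suc (Suc m))"
      "dom1 (mag1 X) (Suc m) h = cmp (mag1 X) m (Suc m) f g"
      "cod1 (mag1 X) (Suc m) h = id1 (mag1 X) m x"
    using fg by (auto simp: equivalent_def)
  have "equivalent (mag1 Y) (Suc m)
      (cmp (mag1 Y) m (Suc m) (fun1 F (Suc m) f) (fun1 F (Suc m) g))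
      (fun1 F (Suc m) (cmp (mag1 X) m (Suc m) f g))"
    by (rule Y.coherent_equivalent[OF coherent_fun1_cmp[OF c]])
  also have "equivalent (mag1 Y) (Suc m) \<dots> (fun1 F (Suc m) (id1 (mag1 X) m x))"
    using h IH fun1_simps(2,3)[OF X.M1.internal_equivalence_cell[OF h(1)]]
    unfolding equivalent_def by (intro bexI[of _ "fun1 F (Suc (Suc m)) h"]) auto
  also have "equivalent (mag1 Y) (Suc m) \<dots> (id1 (mag1 Y) m (fun1 F m x))"
    by (rule Y.coherent_equivalent[OF coherent_fun1_id[OF x]])
  finally show ?thesis .
qed

lemma fun1_internal_equivalence_descend:
  assumes IH: "fun1 F (Suc k) ` internal_equivalences (mag1 X) (Suc k)
      \<subseteq> internal_equivalences (mag1 Y) (Suc k)"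
  shows "fun1 F k ` internal_equivalences (mag1 X) k \<subseteq> internal_equivalences (mag1 Y) k"
proof
  fix f' assume "f' \<in> fun1 F k ` internal_equivalences (mag1 X) k"
  then obtain f where f: "f' = fun1 F k f" "f \<in> internal_equivalences (mag1 X) k" by blast
  obtain m g where k: "k = Suc m" and fg: "quasi_inverse (mag1 X) m f g"
    using X.internal_equivalence_quasi_inverse[OF f(2)] by blast
  then have c: "composable (mag1 X) m (Suc m) f g" "composable (mag1 X) m (Suc m) g f"
      "dom1 (mag1 X) m f \<in> cells (mag1 X) m" "dom1 (mag1 X) m g \<in> cells (mag1 X) m"
    by (auto simp: quasi_inverse_def X.M1.dom1_cell X.M1.cod1_cell)
  have "equivalent (mag1 X) (Suc m) (cmp (mag1 X) m (Suc m) f g) (id1 (mag1 X) m (dom1 (mag1 X) m f))"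
    "equivalent (mag1 X) (Suc m) (cmp (mag1 X) m (Suc m) g f) (id1 (mag1 X) m (dom1 (mag1 X) m g))"
    using fg unfolding quasi_inverse_def by blast+
  note this(1)[THEN fun1_equivalent_id[OF IH[unfolded k] c(1,3)]]
    this(2)[THEN fun1_equivalent_id[OF IH[unfolded k] c(2,4)]]
  then have "quasi_inverse (mag1 Y) m (fun1 F (Suc m) f) (fun1 F (Suc m) g)"
    using fg by (simp add: quasi_inverse_def fun1_simps(1) fun1_simps(2,3)[symmetric])
  then show "f' \<in> internal_equivalences (mag1 Y) k"
    using f k by (intro weakly_invertible_internal) (auto simp: weakly_invertible_iff)
qed

end

theorem theorem49:
  fixes X :: "('a1, 'a2, 'a3) weak_ocat" and Y :: "('b1, 'b2, 'b3) weak_ocat"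
    and F :: "('a1, 'a2, 'a3, 'b1, 'b2, 'b3) pseudofun" and n :: nat
  assumes "omega_pseudofunctor X Y F"
    and "weak_skeletal n X"
    and "weak_skeletal n Y"
  shows "tame X Y F"
proof -
  interpret omega_pseudofunctor X Y F by (fact assms(1))
  let ?P = "\<lambda>k. fun1 F k ` internal_equivalences (mag1 X) k \<subseteq> internal_equivalences (mag1 Y) k"
  have high: "?P k" if "n < k" for k
  proof
    fix y assume "y \<in> fun1 F k ` internal_equivalences (mag1 X) k"
    then have "y \<in> cells (mag1 Y) k"
      using fun1_simps(1) X.M1.internal_equivalence_cell by blast
    then have "y \<in> elementary_equivalences (mag1 Y) k"
      using assms(3) that by (auto simp: weak_skeletal_def skeletal_def elementary_equivalences_def)
    then show "y \<in> internal_equivalences (mag1 Y) k" by (rule elementary_equivalences_internal)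
  qed
  have "?P k" for k
  proof (cases "n < k")
    case False
    then have "k \<le> Suc n" by simp
    then show ?thesis
    proof (induction rule: inc_induct)
      case base
      show ?case by (rule high) simp
    next
      case (step k)
      show ?case by (rule fun1_internal_equivalence_descend[OF step.IH])
    qed
  qed (rule high)
  then show ?thesis by (simp add: tame_def)
qed

end
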